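(* Thompson's group $F$ fixes exactly four profiles of $X_F$ under its action on profiles: $\Delta_L$, $\Delta_R$, $\Delta_{L-R}$ and $\Delta_\infty$.
   Context: Let $\mathcal P=\langle x\mid x=x^2\rangle$. Planar pictures over $\mathcal P$: a frame, transistors (each an $(x,x^2)$-transistor with one top and two bottom wires, or an $(x^2,x)$-transistor with two top and one bottom wire) and wires, each wire from the bottom of a transistor or top of the frame to the top of a transistor or bottom of the frame, embedded in the plane, with "$T_1<T_2$ if a wire runs from the bottom of $T_1$ to the top of $T_2$" generating a strict partial order. Dipoles: pairs $T_1<T_2$ with the bottom contacts of $T_1$ joined in order to the top contacts of $T_2$ and the top label of $T_1$ equal to the bottom label of $T_2$. $F$ is the group of reduced planar $(x,x)$-pictures under concatenation followed by dipole removal (Thompson's group). $X_F$: vertices are reduced planar $(x,* )$-pictures; $n$-cubes are such pictures with $n$ maximal transistors marked white, whose vertices are obtained by keeping/deleting each white transistor with its bottom wires; a CAT(0) cubical complex with an isometric $F$-action (concatenation on top, remove dipoles); base vertex $*$ has no transistors. Hyperplanes: classes of edges under the transitive closure of "opposite sides of a square"; $H^+$ is the component of the complement of $H$ not containing $*$; $H_1^+\le H_2^+$ iff $H_2^+\subseteq H_1^+$. A profile is a nonempty collection of positive half-spaces such that finite subcollections have nonempty intersection, there is no maximal element, and it is downward closed. Action on profiles: for $g\in F$ and a profile $\mathcal H$, choose $\mathcal H'\subseteq\mathcal H$ cofinal (every element of $\mathcal H$ is $\le$ one of $\mathcal H'$) with $g\cdot H^+$ positive for all $H^+\in\mathcal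 H'$; $g*\mathcal H$ is the unique profile cofinal with $g\cdot\mathcal H'$. Minimal vertex $\min(H)$: for an edge of $H$ given by a picture with one white transistor $T$, the picture of all transistors $\le T$; any vertex with a unique maximal transistor is $\min(H)$ for a unique $H$. Finite ordered rooted binary trees (pictures with only $(x,x^2)$-transistors, "carets") are vertices. Label carets of the infinite full binary tree by binary strings (root = empty string; children of $s$ are $s0$ (left), $s1$ (right)). For a set $S$ of binary strings, let $P_S$ be the set of $H^+$ such that $\min(H)$ is the tree whose carets are exactly the prefixes of some $s\in S$. Then $\Delta_\infty=P_S$ with $S$ all binary strings; $\Delta_L=P_{\{0^k:k\ge0\}}$; $\Delta_R=P_{\{1^k:k\ge0\}}$; $\Delta_{L-R}=P_{\{0^k,1^k:k\ge0\}}$. *)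

theory Defs
  imports Main "HOL-Library.Sublist"
begin

text \<open>Encoding. In a reduced picture over x = x^2 no (x^2,x)-transistor lies directly above
an (x,x^2)-transistor (that would be a dipole), so every reduced (x,x^n)-picture consists of a
tree of (x,x^2)-transistors (carets, hanging from the top wire) followed by a forest of n
upside-down trees of (x^2,x)-transistors (merges), one per bottom wire.  A picture is encoded as
such a pair (T, Fs); the leaves of T are glued in order to the leaves of the forest Fs.
A caret of T is named by its binary string (root = [], left child s@[False], right child s@[True]).\<close>

datatype tr = Lf | Nd tr tr

type_synonym pic = "tr \<times> tr list"

fun nlv :: "tr \<Rightarrow> nat" where
  "nlv Lf = 1"
| "nlv (Nd l r) = nlv l + nlv r"

fun leafstrs :: "tr \<Rightarrow> bool list list" where
  "leafstrs Lf = [[]]"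
| "leafstrs (Nd l r) = map (Cons False) (leafstrs l) @ map (Cons True) (leafstrs r)"

fun sib :: "tr \<Rightarrow> nat set" where
  "sib Lf = {}"
| "sib (Nd l r) = sib l \<union> (\<lambda>k. k + nlv l) ` sib r \<union> (if l = Lf \<and> r = Lf then {0} else {})"

fun sibF :: "tr list \<Rightarrow> nat set" where
  "sibF [] = {}"
| "sibF (t # ts) = sib t \<union> (\<lambda>k. k + nlv t) ` sibF ts"

fun contr :: "tr \<Rightarrow> nat \<Rightarrow> tr" where
  "contr Lf k = Lf"
| "contr (Nd l r) k = (if l = Lf \<and> r = Lf then Lf
      else if k < nlv l then Nd (contr l k) r else Nd l (contr r (k - nlv l)))"

fun contrF :: "tr list \<Rightarrow> nat \<Rightarrow> tr list" where
  "contrF [] k = []"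
| "contrF (t # ts) k = (if k < nlv t then contr t k # ts else t # contrF ts (k - nlv t))"

fun splitAt :: "tr \<Rightarrow> nat \<Rightarrow> tr" where
  "splitAt Lf k = Nd Lf Lf"
| "splitAt (Nd l r) k = (if k < nlv l then Nd (splitAt l k) r else Nd l (splitAt r (k - nlv l)))"

fun graft :: "tr \<Rightarrow> tr list \<Rightarrow> tr" where
  "graft Lf xs = hd xs"
| "graft (Nd l r) xs = Nd (graft l (take (nlv l) xs)) (graft r (drop (nlv l) xs))"

fun graftF :: "tr list \<Rightarrow> tr list \<Rightarrow> tr list" where
  "graftF [] xs = []"
| "graftF (t # ts) xs = graft t (take (nlv t) xs) # graftF ts (drop (nlv t) xs)"

fun join :: "tr \<Rightarrow> tr \<Rightarrow> tr" where
  "join Lf t = t"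
| "join (Nd a b) Lf = Nd a b"
| "join (Nd a b) (Nd c d) = Nd (join a c) (join b d)"

fun ext :: "tr \<Rightarrow> tr \<Rightarrow> tr list" where
  "ext Lf u = [u]"
| "ext (Nd l r) (Nd a b) = ext l a @ ext r b"
| "ext (Nd l r) Lf = []"

text \<open>subtree of T consisting of the carets in X (X prefix closed)\<close>
fun prune :: "tr \<Rightarrow> bool list set \<Rightarrow> tr" where
  "prune Lf X = Lf"
| "prune (Nd l r) X = (if [] \<in> X then Nd (prune l {s. False # s \<in> X}) (prune r {s. True # s \<in> X})
      else Lf)"

fun pathtree :: "bool list \<Rightarrow> tr" where
  "pathtree [] = Nd Lf Lf"
| "pathtree (False # s) = Nd (pathtree s) Lf"
| "pathtree (True # s) = Nd Lf (pathtree s)"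

definition wfpic :: "pic \<Rightarrow> bool" where
  "wfpic p \<longleftrightarrow> nlv (fst p) = sum_list (map nlv (snd p))"

text \<open>no dipole: no caret of T whose two bottom wires go straight to the two top wires of a merge\<close>
definition reduced :: "pic \<Rightarrow> bool" where
  "reduced p \<longleftrightarrow> sib (fst p) \<inter> sibF (snd p) = {}"

definition Vert :: "pic set" where
  "Vert = {p. wfpic p \<and> reduced p}"

definition base :: pic where
  "base = (Lf, [Lf])"

text \<open>Thompson's group F: reduced (x,x)-pictures\<close>
definition ThompsonF :: "pic set" where
  "ThompsonF = {p \<in> Vert. length (snd p) = 1}"

definition dstep :: "pic \<Rightarrow> pic \<Rightarrow> bool" where
  "dstep p q \<longleftrightarrow> (\<exists>k \<in> sib (fst p) \<inter> sibF (snd p). q = (contr (fst p) k, contrF (snd p) k))"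

definition red :: "pic \<Rightarrow> pic" where
  "red p = (THE q. dstep\<^sup>*\<^sup>* p q \<and> reduced q)"

text \<open>concatenation of g (on top) with v, after removing the (x^2,x)/(x,x^2) dipoles
  at the junction (common refinement); the remaining dipoles are removed by red\<close>
definition cat :: "pic \<Rightarrow> pic \<Rightarrow> pic" where
  "cat g v = (let U = join (hd (snd g)) (fst v) in
      (graft (fst g) (ext (hd (snd g)) U), graftF (snd v) (ext (fst v) U)))"

definition act :: "pic \<Rightarrow> pic \<Rightarrow> pic" where
  "act g v = red (cat g v)"

text \<open>S i: an (x,x^2)-transistor below bottom wire i; M i: an (x^2,x)-transistor below wires i, i+1\<close>
datatype att = S nat | M nat

definition leafpos :: "tr list \<Rightarrow> nat \<Rightarrow> nat" where
  "leafpos Fs i = sum_list (map nlv (take i Fs))"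

fun add :: "att \<Rightarrow> pic \<Rightarrow> pic" where
  "add (S i) (T, Fs) = (splitAt T (leafpos Fs i), take i Fs @ [Lf, Lf] @ drop (Suc i) Fs)"
| "add (M i) (T, Fs) = (T, take i Fs @ [Nd (Fs ! i) (Fs ! Suc i)] @ drop (Suc (Suc i)) Fs)"

text \<open>Q + a is a (reduced) picture in which a is a maximal transistor\<close>
definition attachable :: "att \<Rightarrow> pic \<Rightarrow> bool" where
  "attachable a p \<longleftrightarrow>
     (case a of S i \<Rightarrow> i < length (snd p) \<and> snd p ! i = Lf | M i \<Rightarrow> Suc i < length (snd p))
     \<and> reduced (add a p)"

fun wires :: "att \<Rightarrow> nat set" where
  "wires (S i) = {i}"
| "wires (M i) = {i, Suc i}"

fun idx :: "att \<Rightarrow> nat" where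
  "idx (S i) = i"
| "idx (M i) = i"

fun setidx :: "att \<Rightarrow> nat \<Rightarrow> att" where
  "setidx (S _) j = S j"
| "setidx (M _) j = M j"

text \<open>re-index b after a has been attached (a, b at disjoint wires)\<close>
fun shift :: "att \<Rightarrow> att \<Rightarrow> att" where
  "shift (S i) b = (if idx b > i then setidx b (idx b + 1) else b)"
| "shift (M i) b = (if idx b > Suc i then setidx b (idx b - 1) else b)"

text \<open>edges: reduced pictures with one white maximal transistor\<close>
definition Edges :: "pic set set" where
  "Edges = {{Q, add a Q} | Q a. Q \<in> Vert \<and> attachable a Q}"

text \<open>squares: reduced pictures Q + a + b with the two white maximal transistors a, b\<close>
definition sq :: "pic \<Rightarrow> att \<Rightarrow> att \<Rightarrow> bool" where
  "sq Q a b \<longleftrightarrow> Q \<in> Vert \<and> attachable a Q \<and> attachable b Q \<and> wires a \<inter> wires b = {}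
      \<and> attachable (shift a b) (add a Q)"

definition opp :: "pic set \<Rightarrow> pic set \<Rightarrow> bool" where
  "opp e f \<longleftrightarrow> (\<exists>Q a b. sq Q a b \<and>
      (let X = add (shift a b) (add a Q) in
        (e = {Q, add a Q} \<and> f = {add b Q, X}) \<or> (e = {Q, add b Q} \<and> f = {add a Q, X})))"

definition Hyps :: "pic set set set" where
  "Hyps = {{f \<in> Edges. (\<lambda>x y. opp x y \<or> opp y x)\<^sup>*\<^sup>* e f} | e. e \<in> Edges}"

text \<open>positive half-space (vertex set) of H: the component of X_F - H not containing base\<close>
definition hplus :: "pic set set \<Rightarrow> pic set" where
  "hplus H = {v \<in> Vert. \<not> (\<lambda>u w. {u, w} \<in> Edges - H)\<^sup>*\<^sup>* base v}"

definition PHS :: "pic set set" where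
  "PHS = hplus ` Hyps"

definition hle :: "pic set \<Rightarrow> pic set \<Rightarrow> bool" where
  "hle h1 h2 \<longleftrightarrow> h2 \<subseteq> h1"

definition profile :: "pic set set \<Rightarrow> bool" where
  "profile \<H> \<longleftrightarrow> \<H> \<noteq> {} \<and> \<H> \<subseteq> PHS
     \<and> (\<forall>\<F>. \<F> \<subseteq> \<H> \<and> finite \<F> \<longrightarrow> \<Inter>\<F> \<noteq> {})
     \<and> (\<forall>h\<in>\<H>. \<exists>h'\<in>\<H>. hle h h' \<and> h \<noteq> h')
     \<and> (\<forall>h\<in>PHS. \<forall>h'\<in>\<H>. hle h h' \<longrightarrow> h \<in> \<H>)"

definition cofinal :: "pic set set \<Rightarrow> pic set set \<Rightarrow> bool" where
  "cofinal A B \<longleftrightarrow> (\<forall>h\<in>B. \<exists>h'\<in>A. hle h h')"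

definition gH :: "pic \<Rightarrow> pic set \<Rightarrow> pic set" where
  "gH g h = act g ` h"

definition pact :: "pic \<Rightarrow> pic set set \<Rightarrow> pic set set" where
  "pact g \<H> = (THE \<K>. profile \<K> \<and>
      (\<exists>\<H>'. \<H>' \<subseteq> \<H> \<and> cofinal \<H>' \<H> \<and> (\<forall>h\<in>\<H>'. gH g h \<in> PHS)
             \<and> gH g ` \<H>' \<subseteq> \<K> \<and> cofinal (gH g ` \<H>') \<K>))"

text \<open>min vertex for the edge {Q, Q + a}: the subpicture of all transistors \<le> a in Q + a\<close>
definition minE :: "pic \<Rightarrow> att \<Rightarrow> pic" where
  "minE Q a = (let P = add a Q; T = fst P; Fs = snd P in
     (case a of
        S i \<Rightarrow> (let s = leafstrs (fst Q) ! leafpos (snd Q) i;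
                    C = prune T {p. prefix p s} in (C, replicate (nlv C) Lf))
      | M i \<Rightarrow> (let m = Fs ! i; k0 = leafpos Fs i;
                    L = set (take (nlv m) (drop k0 (leafstrs T)));
                    C = prune T {p. \<exists>s\<in>L. strict_prefix p s};
                    p0 = length (takeWhile (\<lambda>s. s \<notin> L) (leafstrs C))
                in (C, replicate p0 Lf @ [m] @ replicate (nlv C - p0 - nlv m) Lf))))"

definition PS :: "bool list set \<Rightarrow> pic set set" where
  "PS Sset = {hplus H | H. H \<in> Hyps \<and>
      (\<exists>Q a s. Q \<in> Vert \<and> attachable a Q \<and> {Q, add a Q} \<in> H \<and> s \<in> Sset
         \<and> minE Q a = (pathtree s, replicate (nlv (pathtree s)) Lf))}"

definition DeltaInf :: "pic set set" where "DeltaInf = PS UNIV"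
definition DeltaL :: "pic set set" where "DeltaL = PS (range (\<lambda>k. replicate k False))"
definition DeltaR :: "pic set set" where "DeltaR = PS (range (\<lambda>k. replicate k True))"
definition DeltaLR :: "pic set set" where
  "DeltaLR = PS (range (\<lambda>k. replicate k False) \<union> range (\<lambda>k. replicate k True))"

end

theory Submission
  imports Defs
begin

text \<open>
  A vertex is read as the list of its bottom wires, a wire being a binary tree of merges whose
  leaves are binary strings (the wires of the infinite caret tree).  Reduced wires are the normal
  forms of the free Jonsson-Tarski algebra on one generator, and \<open>F\<close> acts on them by
  substituting the image of the root wire.  In this language the complex is the configuration
  complex of an event structure whose events are the transistors: hyperplanes correspond to
  transistors, a positive half-space consists of the vertices containing a given transistor, and
  profiles are the infinite configurations without maximal transistors.

  An element of \<open>F\<close> sends all but boundedly many transistors to transistors of the same kind, so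
  the action on profiles is push-forward followed by downward closure.  A fixed profile contains no
  merge, since an element supported below a leaf \<open>s\<close> of a merge would create a caret at \<open>s\<close>.  So it is
  a pruned set of binary strings, and \<open>F\<close> is transitive on the strings containing both letters.
\<close>

section \<open>Wires\<close>

text \<open>Two definite descriptions in the definitions need uniqueness. For \<open>red\<close> no
  confluence argument is used: \<open>nf\<close> of the wires does not change under a dipole
  removal, and the wires of a reduced picture are their own normal forms. For \<open>pact\<close>
  the point is that \<open>g\<close> preserves inclusions, so any two cofinal choices generate the
  same profile. For \<open>g = (A, [B])\<close> the image of the root wire is the merge tree
  \<open>B\<close> with the leaf strings of \<open>A\<close> at its leaves, normalised by
  \<open>mk\<close>. A caret whose path ends strictly inside \<open>B\<close> becomes a merge, and
  the inverse does the reverse; this is why \<open>g\<close> is only a partial map on transistors. A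
  profile has no maximal element, hence transistors of unbounded size, and the bounded exceptions
  can be bypassed. A merge with leaf \<open>s\<close> consumes the wire \<open>s\<close> and so
  excludes a caret at \<open>s\<close>; the finite intersection condition turns this conflict into
  the contradiction behind the absence of merges. Strings with a single letter are outermost leaves
  of every tree that has them, which \<open>F\<close> respects; a string with both letters can be
  given any sufficiently large number of leaves on either side.\<close>

text \<open>\<open>Str s\<close> is the wire of the infinite caret tree with address \<open>s\<close>, and \<open>Mrg a b\<close> the wire
below a merge of \<open>a\<close> and \<open>b\<close>.\<close>
datatype wire = Str "bool list" | Mrg wire wire

fun labels :: "wire \<Rightarrow> bool list list" where
  "labels (Str s) = [s]"
| "labels (Mrg a b) = labels a @ labels b"

text \<open>The product of the Jonsson-Tarski algebra; its two projections are \<open>pr False\<close> and \<open>pr True\<close>.\<close>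
definition mk :: "wire \<Rightarrow> wire \<Rightarrow> wire" where
  "mk a b = (if \<exists>u. a = Str (u @ [False]) \<and> b = Str (u @ [True])
     then Str (THE u. a = Str (u @ [False])) else Mrg a b)"

text \<open>One bottom-up pass is enough: collapsing a pair of sibling strings can create a new
  dipole only at the parent, where \<open>mk\<close> is applied next.\<close>

fun nf :: "wire \<Rightarrow> wire" where
  "nf (Str s) = Str s"
| "nf (Mrg a b) = mk (nf a) (nf b)"

fun irr :: "wire \<Rightarrow> bool" where
  "irr (Str s) \<longleftrightarrow> True"
| "irr (Mrg a b) \<longleftrightarrow> irr a \<and> irr b \<and> (\<forall>u. \<not> (a = Str (u @ [False]) \<and> b = Str (u @ [True])))"

fun pr :: "bool \<Rightarrow> wire \<Rightarrow> wire" where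
  "pr c (Str s) = Str (s @ [c])"
| "pr c (Mrg a b) = (if c then b else a)"

text \<open>The subwire reached from \<open>w\<close> along the path \<open>s\<close>: each caret on
  the path cancels a merge, or lengthens the string once the merges are used up.\<close>

fun desc :: "bool list \<Rightarrow> wire \<Rightarrow> wire" where
  "desc [] w = w"
| "desc (c # s) w = desc s (pr c w)"

text \<open>The endomorphism of the algebra that sends the generator \<open>Str []\<close> to
  \<open>t\<close>, computed on normal forms.\<close>

fun subst :: "wire \<Rightarrow> wire \<Rightarrow> wire" where
  "subst t (Str s) = desc s t"
| "subst t (Mrg a b) = mk (subst t a) (subst t b)"

lemma labels_nonempty [simp]: "labels w \<noteq> []"
  by (induction w) auto

lemma mk_dip [simp]: "mk (Str (u @ [False])) (Str (u @ [True])) = Str u"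
  by (auto simp: mk_def)

lemma mk_nodip: "\<forall>u. \<not> (a = Str (u @ [False]) \<and> b = Str (u @ [True])) \<Longrightarrow> mk a b = Mrg a b"
  by (auto simp: mk_def)

lemma mk_Mrg [simp]: "mk (Mrg a b) c = Mrg (Mrg a b) c" "mk c (Mrg a b) = Mrg c (Mrg a b)"
  by (auto simp: mk_def)

lemma mk_cases:
  obtains u where "a = Str (u @ [False])" "b = Str (u @ [True])" "mk a b = Str u"
  | "\<forall>u. \<not> (a = Str (u @ [False]) \<and> b = Str (u @ [True]))" "mk a b = Mrg a b"
  using mk_nodip mk_dip by metis

lemma pr_mk [simp]: "pr c (mk a b) = (if c then b else a)"
  by (cases a b rule: mk_cases) auto

lemma nf_irr: "irr w \<Longrightarrow> nf w = w"
  by (induction w) (auto simp: mk_nodip)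

lemma irr_pr: "irr w \<Longrightarrow> irr (pr c w)"
  by (cases w) auto

lemma irr_desc: "irr w \<Longrightarrow> irr (desc s w)"
  by (induction s arbitrary: w) (auto simp: irr_pr)

lemma mk_pr: "irr w \<Longrightarrow> mk (pr False w) (pr True w) = w"
  by (cases w) (auto simp: mk_nodip)

lemma desc_append: "desc (s @ s') w = desc s' (desc s w)"
  by (induction s arbitrary: w) auto

lemma desc_Str [simp]: "desc s (Str a) = Str (a @ s)"
  by (induction s arbitrary: a) auto

lemma subst_pr: "subst t (pr c x) = pr c (subst t x)"
  by (cases x) (auto simp: desc_append)

lemma subst_desc: "subst t (desc s x) = desc s (subst t x)"
  by (induction s arbitrary: x) (auto simp: subst_pr)

text \<open>The case with content is a collapsing \<open>mk\<close>: there the two projections of an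
  irreducible wire have to recombine to it, which is \<open>mk_pr\<close> and fails for reducible
  wires.\<close>

lemma subst_mk: "irr t \<Longrightarrow> subst t (mk a b) = mk (subst t a) (subst t b)"
  by (cases a b rule: mk_cases) (auto simp: desc_append mk_pr irr_desc)

lemma subst_subst: "irr t \<Longrightarrow> subst t (subst u x) = subst (subst t u) x"
  by (induction x) (auto simp: subst_desc subst_mk)

lemma subst_id: "irr x \<Longrightarrow> subst (Str []) x = x"
  by (induction x) (auto simp: mk_nodip)

section \<open>Leaf strings of finite trees\<close>

lemma nlv_pos [simp]: "0 < nlv t"
  by (induction t) auto

lemma length_leafstrs [simp]: "length (leafstrs t) = nlv t"
  by (induction t) auto

lemma leafstrs_nonempty [simp]: "leafstrs t \<noteq> []"
  by (metis length_leafstrs list.size(3) nlv_pos less_irrefl)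

lemma Nil_in_leafstrs [simp]: "[] \<in> set (leafstrs t) \<longleftrightarrow> t = Lf"
  by (cases t) auto

text \<open>The first letter of a string tells which block it belongs to, so filtering by
  \<open>hd\<close> recovers both blocks.\<close>

lemma append_map_Cons_eq:
  assumes "map (Cons False) a @ map (Cons True) b = map (Cons False) a' @ map (Cons True) b'"
  shows "a = a' \<and> b = b'"
proof -
  have "filter (\<lambda>s. \<not> hd s) (map (Cons False) a @ map (Cons True) b) = map (Cons False) a"
       "filter hd (map (Cons False) a @ map (Cons True) b) = map (Cons True) b" for a b :: "bool list list"
    by (simp_all add: filter_map comp_def)
  then have "map (Cons False) a = map (Cons False) a'" "map (Cons True) b = map (Cons True) b'"
    using assms by metis+
  then show ?thesis by (simp add: inj_map_eq_map)
qed

lemma leafstrs_inject: "leafstrs t = leafstrs u \<longleftrightarrow> t = u"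
proof (induction t arbitrary: u)
  case Lf
  then show ?case by (metis Nil_in_leafstrs leafstrs.simps(1) list.set_intros(1))
next
  case (Nd l r)
  show ?case
  proof (cases u)
    case Lf
    then show ?thesis
      by (metis Nil_in_leafstrs leafstrs.simps(1) list.set_intros(1))
  next
    case (Nd l' r')
    have "leafstrs (Nd l r) = leafstrs (Nd l' r') \<Longrightarrow> leafstrs l = leafstrs l' \<and> leafstrs r = leafstrs r'"
      unfolding leafstrs.simps by (rule append_map_Cons_eq)
    then show ?thesis using Nd.IH Nd by blast
  qed
qed

lemma leafstrs_antichain:
  "s \<in> set (leafstrs t) \<Longrightarrow> s' \<in> set (leafstrs t) \<Longrightarrow> prefix s s' \<Longrightarrow> s = s'"
proof (induction t arbitrary: s s')
  case (Nd l r)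
  then show ?case by (auto simp: prefix_Cons)
qed simp

lemma distinct_leafstrs: "distinct (leafstrs t)"
  by (induction t) (auto simp: distinct_map)

text \<open>The trees are full: a string strictly above a leaf is a caret, and every caret has
  leaves on both sides.\<close>

lemma strict_prefix_leafD:
  "l \<in> set (leafstrs t) \<Longrightarrow> prefix (s @ [c]) l \<Longrightarrow> \<exists>l' \<in> set (leafstrs t). prefix (s @ [d]) l'"
proof (induction t arbitrary: s l)
  case (Nd a b)
  show ?case
  proof (cases s)
    case Nil
    have "hd (leafstrs a) \<in> set (leafstrs a)" "hd (leafstrs b) \<in> set (leafstrs b)" by auto
    then show ?thesis unfolding Nil
      using list.set_intros(1) by (cases d) (force intro!: bexI[of _ "d # hd (leafstrs (if d then b else a))"])+
  next
    case (Cons e s')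
    then obtain l' where l': "l = e # l'" "prefix (s' @ [c]) l'" using Nd.prems(2) by (cases l) auto
    show ?thesis
    proof (cases e)
      case True
      then have "l' \<in> set (leafstrs b)" using Nd.prems l' by auto
      from Nd.IH(2)[OF this l'(2)] obtain x where "x \<in> set (leafstrs b)" "prefix (s' @ [d]) x" by blast
      then have "True # x \<in> set (leafstrs (Nd a b))" "prefix (s @ [d]) (True # x)" using Cons True by auto
      then show ?thesis by blast
    next
      case False
      then have "l' \<in> set (leafstrs a)" using Nd.prems l' by auto
      from Nd.IH(1)[OF this l'(2)] obtain x where "x \<in> set (leafstrs a)" "prefix (s' @ [d]) x" by blast
      then have "False # x \<in> set (leafstrs (Nd a b))" "prefix (s @ [d]) (False # x)" using Cons False by auto
      then show ?thesis by blast
    qed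
  qed
qed auto

lemma sib_bound: "k \<in> sib t \<Longrightarrow> Suc k < nlv t"
  by (induction t arbitrary: k) (auto simp: trans_less_add1 split: if_splits)

text \<open>Consecutive leaves from different subtrees of a node are siblings only if both subtrees
  are leaves, which is the \<open>{0}\<close> clause of \<open>sib\<close>. Dipole positions become
  a condition on strings.\<close>

lemma sib_iff:
  "k \<in> sib t \<longleftrightarrow> Suc k < nlv t \<and> (\<exists>u. leafstrs t ! k = u @ [False] \<and> leafstrs t ! Suc k = u @ [True])"
proof (induction t arbitrary: k)
  case (Nd l r)
  consider "Suc k < nlv l" | "Suc k = nlv l" | j where "k = j + nlv l"
    by (metis le_add_diff_inverse2 not_less_eq nat_neq_iff less_or_eq_imp_le less_Suc_eq_le)
  then show ?case
  proof cases
    case 1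
    have "(\<exists>u. False # leafstrs l ! k = u @ [False] \<and> False # leafstrs l ! Suc k = u @ [True])
      \<longleftrightarrow> (\<exists>u. leafstrs l ! k = u @ [False] \<and> leafstrs l ! Suc k = u @ [True])"
      by (auto simp: Cons_eq_append_conv)
    moreover have "k \<in> sib (Nd l r) \<longleftrightarrow> k \<in> sib l" using 1 by auto
    ultimately show ?thesis using 1 Nd.IH(1)[of k]
      by (simp del: sib.simps add: nth_append)
  next
    case 2
    have *: "leafstrs (Nd l r) ! k = False # leafstrs l ! k" 
      "leafstrs (Nd l r) ! Suc k = True # leafstrs r ! 0"
      using 2 by (auto simp: nth_append)
    have "(\<exists>u. False # leafstrs l ! k = u @ [False] \<and> True # leafstrs r ! 0 = u @ [True])
       \<longleftrightarrow> leafstrs l ! k = [] \<and> leafstrs r ! 0 = []"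
      by (auto simp: Cons_eq_append_conv)
    also have "\<dots> \<longleftrightarrow> l = Lf \<and> r = Lf"
    proof
      have "leafstrs l ! k \<in> set (leafstrs l)" "leafstrs r ! 0 \<in> set (leafstrs r)"
        using 2 by auto
      then show "l = Lf \<and> r = Lf" if "leafstrs l ! k = [] \<and> leafstrs r ! 0 = []"
        using that by auto
    next
      show "leafstrs l ! k = [] \<and> leafstrs r ! 0 = []" if "l = Lf \<and> r = Lf"
        using that 2 by auto
    qed
    also have "\<dots> \<longleftrightarrow> k \<in> sib (Nd l r)"
      using 2 sib_bound[of k l] by auto
    finally show ?thesis unfolding * using 2 by simp
  next
    case 3
    have "k \<in> sib (Nd l r) \<longleftrightarrow> j \<in> sib r" using 3 sib_bound[of k l] by auto
    moreover have "leafstrs (Nd l r) ! k = True # leafstrs r ! j" if "j < nlv r"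
      using 3 that by (auto simp: nth_append)
    moreover have "leafstrs (Nd l r) ! Suc k = True # leafstrs r ! Suc j" if "Suc j < nlv r"
      using 3 that by (auto simp: nth_append)
    moreover have "(\<exists>u. True # leafstrs r ! j = u @ [False] \<and> True # leafstrs r ! Suc j = u @ [True])
      \<longleftrightarrow> (\<exists>u. leafstrs r ! j = u @ [False] \<and> leafstrs r ! Suc j = u @ [True])"
      by (auto simp: Cons_eq_append_conv)
    ultimately show ?thesis
      by (cases "Suc j < nlv r") (simp_all del: sib.simps leafstrs.simps add: 3 Nd.IH(2)[of j])
  qed
qed auto

lemma leafstrs_contr:
  "k \<in> sib t \<Longrightarrow> \<exists>xs u ys. leafstrs t = xs @ [u @ [False], u @ [True]] @ ys \<and> length xs = k
     \<and> leafstrs (contr t k) = xs @ [u] @ ys"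
proof (induction t arbitrary: k)
  case (Nd l r)
  show ?case
  proof (cases "l = Lf \<and> r = Lf")
    case True
    then show ?thesis using Nd.prems by auto
  next
    case False
    then consider "k \<in> sib l" | j where "k = j + nlv l" "j \<in> sib r" using Nd.prems by auto
    then show ?thesis
    proof cases
      case 1
      then obtain xs u ys where *: "leafstrs l = xs @ [u @ [False], u @ [True]] @ ys" "length xs = k"
        "leafstrs (contr l k) = xs @ [u] @ ys" using Nd.IH(1) by blast
      have "k < nlv l" using 1 sib_bound by force
      then show ?thesis using * False
        by (intro exI[of _ "map (Cons False) xs"] exI[of _ "False # u"]
            exI[of _ "map (Cons False) ys @ map (Cons True) (leafstrs r)"]) auto
    next
      case 2
      then obtain xs u ys where *: "leafstrs r = xs @ [u @ [False], u @ [True]] @ ys" "length xs = j"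
        "leafstrs (contr r j) = xs @ [u] @ ys" using Nd.IH(2) by blast
      then show ?thesis using * False 2
        by (intro exI[of _ "map (Cons False) (leafstrs l) @ map (Cons True) xs"] exI[of _ "True # u"]
            exI[of _ "map (Cons True) ys"]) auto
    qed
  qed
qed auto

lemma leafstrs_splitAt:
  "leafstrs t = xs @ [u] @ ys \<Longrightarrow> leafstrs (splitAt t (length xs)) = xs @ [u @ [False], u @ [True]] @ ys"
proof (induction t arbitrary: xs u ys)
  case Lf
  then show ?case by (auto simp: Cons_eq_append_conv)
next
  case (Nd l r)
  show ?case
  proof (cases "length xs < nlv l")
    case True
    let ?k = "length xs"
    let ?xs = "take ?k (leafstrs l)" let ?u = "leafstrs l ! ?k" let ?ys = "drop (Suc ?k) (leafstrs l)"
    have 1: "leafstrs l = ?xs @ [?u] @ ?ys" using True by (simp add: id_take_nth_drop)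
    have "xs @ [u] @ ys = map (Cons False) ?xs @ [False # ?u] @ map (Cons False) ?ys @ map (Cons True) (leafstrs r)"
      using Nd.prems 1 by (metis (no_types, lifting) append.assoc leafstrs.simps(2) list.simps(9) map_append list.map(1))
    then have "xs = map (Cons False) ?xs \<and> u = False # ?u \<and> ys = map (Cons False) ?ys @ map (Cons True) (leafstrs r)"
      using True by (subst (asm) append_eq_append_conv) auto
    moreover have "length ?xs = ?k" using True by simp
    ultimately show ?thesis using Nd.IH(1)[OF 1] True by simp
  next
    case False
    define j where "j = length xs - nlv l"
    let ?xs = "take j (leafstrs r)" let ?u = "leafstrs r ! j" let ?ys = "drop (Suc j) (leafstrs r)"
    have "length (leafstrs (Nd l r)) = length xs + 1 + length ys" using Nd.prems by simp
    then have j: "j < nlv r" using False j_def by simp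
    then have 1: "leafstrs r = ?xs @ [?u] @ ?ys" by (simp add: id_take_nth_drop)
    have "xs @ [u] @ ys = (map (Cons False) (leafstrs l) @ map (Cons True) ?xs) @ [True # ?u] @ map (Cons True) ?ys"
      using Nd.prems 1 by (metis (no_types, lifting) append.assoc leafstrs.simps(2) list.simps(9) map_append list.map(1))
    then have "xs = map (Cons False) (leafstrs l) @ map (Cons True) ?xs \<and> u = True # ?u \<and> ys = map (Cons True) ?ys"
      using False j j_def by (subst (asm) append_eq_append_conv) auto
    moreover have "length ?xs = j" using j by simp
    ultimately show ?thesis using Nd.IH(2)[OF 1] False j_def by simp
  qed
qed

section \<open>Vertices as lists of wires\<close>

text \<open>Inverse to the pair of \<open>shape\<close> and \<open>labels\<close>: a wire is a merge
  tree together with the strings at its leaves.\<close>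

fun lab :: "tr \<Rightarrow> bool list list \<Rightarrow> wire" where
  "lab Lf ss = Str (hd ss)"
| "lab (Nd l r) ss = Mrg (lab l (take (nlv l) ss)) (lab r (drop (nlv l) ss))"

fun labF :: "tr list \<Rightarrow> bool list list \<Rightarrow> wire list" where
  "labF [] ss = []"
| "labF (t # ts) ss = lab t (take (nlv t) ss) # labF ts (drop (nlv t) ss)"

abbreviation nlvF :: "tr list \<Rightarrow> nat" where
  "nlvF ts \<equiv> sum_list (map nlv ts)"

fun shape :: "wire \<Rightarrow> tr" where
  "shape (Str s) = Lf"
| "shape (Mrg a b) = Nd (shape a) (shape b)"

abbreviation labelsF :: "wire list \<Rightarrow> bool list list" where
  "labelsF ws \<equiv> concat (map labels ws)"

definition wires_of :: "pic \<Rightarrow> wire list" where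
  "wires_of v = labF (snd v) (leafstrs (fst v))"

text \<open>The image of \<open>Vert\<close> under \<open>wires_of\<close>: the range condition
  replaces \<open>wfpic\<close>, irreducibility replaces \<open>reduced\<close>.\<close>

definition Conf :: "wire list set" where
  "Conf = {ws. labelsF ws \<in> range leafstrs \<and> (\<forall>w\<in>set ws. irr w)}"

lemma nlv_shape [simp]: "nlv (shape w) = length (labels w)"
  by (induction w) auto

lemma nlvF_shape: "nlvF (map shape ws) = length (labelsF ws)"
  by (induction ws) auto

lemma labels_lab: "length ss = nlv t \<Longrightarrow> labels (lab t ss) = ss"
proof (induction t arbitrary: ss)
  case Lf
  then show ?case by (cases ss) auto
qed simp

lemma labels_labF: "length ss = nlvF ts \<Longrightarrow> labelsF (labF ts ss) = ss"
  by (induction ts arbitrary: ss) (auto simp: labels_lab)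

lemma shape_lab [simp]: "shape (lab t ss) = t"
  by (induction t arbitrary: ss) auto

lemma shape_labF [simp]: "map shape (labF ts ss) = ts"
  by (induction ts arbitrary: ss) auto

lemma length_labF [simp]: "length (labF ts ss) = length ts"
  by (induction ts arbitrary: ss) auto

lemma lab_shape [simp]: "lab (shape w) (labels w) = w"
  by (induction w) auto

lemma labF_shape: "labF (map shape ws) (labelsF ws) = ws"
  by (induction ws) auto

lemma labels_wires_of: "wfpic v \<Longrightarrow> labelsF (wires_of v) = leafstrs (fst v)"
  by (simp add: wires_of_def wfpic_def labels_labF)

lemma shape_wires_of: "map shape (wires_of v) = snd v"
  by (simp add: wires_of_def)

lemma length_wires_of [simp]: "length (wires_of v) = length (snd v)"
  by (simp add: wires_of_def)

lemma wires_of_inject: "wfpic v \<Longrightarrow> wfpic v' \<Longrightarrow> wires_of v = wires_of v' \<longleftrightarrow> v = v'"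
  by (metis labels_wires_of leafstrs_inject prod.collapse shape_wires_of)

lemma wires_of_shape:
  assumes "labelsF ws = leafstrs T"
  shows "wires_of (T, map shape ws) = ws" "wfpic (T, map shape ws)"
  using assms labF_shape[of ws] nlvF_shape[of ws]
  by (simp_all add: wires_of_def wfpic_def)

text \<open>Only a merge of two leaves can complete a dipole, and \<open>sib t\<close> lists exactly
  these nodes of \<open>t\<close>.\<close>

lemma irr_lab:
  "length ss = nlv t \<Longrightarrow>
    irr (lab t ss) \<longleftrightarrow> \<not> (\<exists>k\<in>sib t. \<exists>u. ss ! k = u @ [False] \<and> ss ! Suc k = u @ [True])"
proof (induction t arbitrary: ss)
  case (Nd l r)
  let ?P = "\<lambda>ss k. \<exists>u. ss ! k = u @ [False] \<and> ss ! Suc k = u @ [True]"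
  let ?a = "take (nlv l) ss" and ?b = "drop (nlv l) ss"
  have "(\<exists>k\<in>sib l. ?P ss k) \<longleftrightarrow> (\<exists>k\<in>sib l. ?P ?a k)"
    using sib_bound by (intro bex_cong refl) force
  then have 1: "irr (lab l ?a) \<longleftrightarrow> \<not> (\<exists>k\<in>sib l. ?P ss k)"
    using Nd.IH(1)[of ?a] Nd.prems by simp
  have "(\<exists>k\<in>(\<lambda>k. k + nlv l) ` sib r. ?P ss k) \<longleftrightarrow> (\<exists>k\<in>sib r. ?P ?b k)"
    using Nd.prems by (simp add: add.commute)
  then have 2: "irr (lab r ?b) \<longleftrightarrow> \<not> (\<exists>k\<in>(\<lambda>k. k + nlv l) ` sib r. ?P ss k)"
    using Nd.IH(2)[of ?b] Nd.prems by simp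
  have 3: "(\<exists>u. lab l ?a = Str (u @ [False]) \<and> lab r ?b = Str (u @ [True]))
    \<longleftrightarrow> l = Lf \<and> r = Lf \<and> ?P ss 0"
  proof (cases "l = Lf \<and> r = Lf")
    case True
    then show ?thesis using Nd.prems by (cases ss; cases "tl ss") auto
  next
    case False
    then show ?thesis by (cases l; cases r) auto
  qed
  show ?case unfolding lab.simps irr.simps 1 2 not_ex[symmetric] 3 by auto
qed simp

lemma irr_labF:
  "length ss = nlvF ts \<Longrightarrow>
    (\<forall>w\<in>set (labF ts ss). irr w) \<longleftrightarrow> \<not> (\<exists>k\<in>sibF ts. \<exists>u. ss ! k = u @ [False] \<and> ss ! Suc k = u @ [True])"
proof (induction ts arbitrary: ss)
  case (Cons t ts)
  let ?P = "\<lambda>ss k. \<exists>u. ss ! k = u @ [False] \<and> ss ! Suc k = u @ [True]"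
  let ?a = "take (nlv t) ss" and ?b = "drop (nlv t) ss"
  have "(\<exists>k\<in>sib t. ?P ss k) \<longleftrightarrow> (\<exists>k\<in>sib t. ?P ?a k)"
    using sib_bound by (intro bex_cong refl) force
  then have 1: "irr (lab t ?a) \<longleftrightarrow> \<not> (\<exists>k\<in>sib t. ?P ss k)"
    using irr_lab[of ?a] Cons.prems by simp
  have "(\<exists>k\<in>(\<lambda>k. k + nlv t) ` sibF ts. ?P ss k) \<longleftrightarrow> (\<exists>k\<in>sibF ts. ?P ?b k)"
    using Cons.prems by (simp add: add.commute)
  then have 2: "(\<forall>w\<in>set (labF ts ?b). irr w) \<longleftrightarrow> \<not> (\<exists>k\<in>(\<lambda>k. k + nlv t) ` sibF ts. ?P ss k)"
    using Cons.IH[of ?b] Cons.prems by simp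
  have "(\<forall>w\<in>set (labF (t # ts) ss). irr w) \<longleftrightarrow> irr (lab t ?a) \<and> (\<forall>w\<in>set (labF ts ?b). irr w)"
    by simp
  then show ?case unfolding 1 2 by auto
qed simp

lemma sibF_bound: "k \<in> sibF ts \<Longrightarrow> Suc k < nlvF ts"
proof (induction ts arbitrary: k)
  case (Cons t ts)
  then show ?case using sib_bound by (auto simp: trans_less_add1)
qed simp

lemma reduced_iff: 
  assumes "wfpic v"
  shows "reduced v \<longleftrightarrow> (\<forall>w\<in>set (wires_of v). irr w)"
proof -
  have "length (leafstrs (fst v)) = nlvF (snd v)" using assms by (simp add: wfpic_def)
  note irr = irr_labF[OF this]
  have "k \<in> sib (fst v) \<longleftrightarrow> (\<exists>u. leafstrs (fst v) ! k = u @ [False] \<and> leafstrs (fst v) ! Suc k = u @ [True])"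
    if "k \<in> sibF (snd v)" for k
    using sibF_bound[OF that] assms by (simp add: sib_iff wfpic_def)
  then show ?thesis unfolding reduced_def wires_of_def irr by blast
qed

lemma Vert_iff: "v \<in> Vert \<longleftrightarrow> wfpic v \<and> (\<forall>w\<in>set (wires_of v). irr w)"
  unfolding Vert_def using reduced_iff by blast

lemma wires_of_Conf: "v \<in> Vert \<Longrightarrow> wires_of v \<in> Conf"
  by (auto simp: Vert_iff Conf_def labels_wires_of)

lemma Conf_obtain:
  assumes "ws \<in> Conf" obtains v where "v \<in> Vert" "wires_of v = ws"
  using assms wires_of_shape unfolding Conf_def Vert_iff by (metis (mono_tags, lifting) imageE mem_Collect_eq)

lemma Vert_eqI: "v \<in> Vert \<Longrightarrow> v' \<in> Vert \<Longrightarrow> wires_of v = wires_of v' \<Longrightarrow> v = v'"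
  by (metis wires_of_inject Vert_iff)

text \<open>Contracting a dipole is one rewriting step of the wire, which \<open>nf\<close> does not
  see. The leaf count is carried along because it decides where \<open>lab\<close> cuts the list of
  strings.\<close>

lemma lab_contr:
  "length xs \<in> sib t \<Longrightarrow> length xs + length ys + 2 = nlv t \<Longrightarrow>
    nf (lab (contr t (length xs)) (xs @ [u] @ ys)) = nf (lab t (xs @ [u @ [False], u @ [True]] @ ys))
    \<and> Suc (nlv (contr t (length xs))) = nlv t"
proof (induction t arbitrary: xs ys)
  case (Nd l r)
  show ?case
  proof (cases "l = Lf \<and> r = Lf")
    case True
    then show ?thesis using Nd.prems by auto
  next
    case False
    then consider "length xs \<in> sib l" | j where "length xs = j + nlv l" "j \<in> sib r" using Nd.prems by auto
    then show ?thesis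
    proof cases
      case 1
      note b = sib_bound[OF 1]
      \<comment> \<open>The left subtree has \<open>length xs\<close> leaves before the dipole and
        two in it; this many strings of \<open>ys\<close> still belong to it.\<close>
      define ys1 ys2 where "ys1 = take (nlv l - 2 - length xs) ys" and "ys2 = drop (nlv l - 2 - length xs) ys"
      have ys: "ys = ys1 @ ys2" and len: "length xs + length ys1 + 2 = nlv l"
        using b Nd.prems(2) by (auto simp: ys1_def ys2_def)
      from Nd.IH(1)[OF 1 len] have *: "nf (lab (contr l (length xs)) (xs @ [u] @ ys1))
          = nf (lab l (xs @ [u @ [False], u @ [True]] @ ys1))"
        and **: "Suc (nlv (contr l (length xs))) = nlv l" by auto
      then have "nlv (contr l (length xs)) = length (xs @ [u] @ ys1)" using len by simp
      then have e1: "lab (contr (Nd l r) (length xs)) (xs @ [u] @ ys) =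
          Mrg (lab (contr l (length xs)) (xs @ [u] @ ys1)) (lab r ys2)"
        using False b by (simp add: ys)
      have e2: "lab (Nd l r) (xs @ [u @ [False], u @ [True]] @ ys) =
          Mrg (lab l (xs @ [u @ [False], u @ [True]] @ ys1)) (lab r ys2)"
        using len[symmetric] by (simp add: ys)
      have e3: "contr (Nd l r) (length xs) = Nd (contr l (length xs)) r" using False b by simp
      show ?thesis unfolding e1 e2 using * ** by (simp add: e3 del: contr.simps)
    next
      case 2
      define xs1 xs2 where "xs1 = take (nlv l) xs" and "xs2 = drop (nlv l) xs"
      have xs: "xs = xs1 @ xs2" and len: "length xs1 = nlv l" "length xs2 = j"
        using 2 by (auto simp: xs1_def xs2_def)
      have "nf (lab (contr r (length xs2)) (xs2 @ [u] @ ys)) = nf (lab r (xs2 @ [u @ [False], u @ [True]] @ ys))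
         \<and> Suc (nlv (contr r (length xs2))) = nlv r"
        using 2 len Nd.prems(2) by (intro Nd.IH(2)) auto
      moreover have "contr (Nd l r) (length xs) = Nd l (contr r (length xs2))" using False len by (simp add: xs)
      ultimately show ?thesis using 2 len by (simp add: xs del: contr.simps)
    qed
  qed
qed simp

lemma labF_contrF:
  "length xs \<in> sibF ts \<Longrightarrow> length xs + length ys + 2 = nlvF ts \<Longrightarrow>
    map nf (labF (contrF ts (length xs)) (xs @ [u] @ ys)) = map nf (labF ts (xs @ [u @ [False], u @ [True]] @ ys))
    \<and> Suc (nlvF (contrF ts (length xs))) = nlvF ts \<and> length (contrF ts (length xs)) = length ts"
proof (induction ts arbitrary: xs ys)
  case (Cons t ts)
  then consider "length xs \<in> sib t" | j where "length xs = j + nlv t" "j \<in> sibF ts" by auto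
  then show ?case
  proof cases
    case 1
    note b = sib_bound[OF 1]
    define ys1 ys2 where "ys1 = take (nlv t - 2 - length xs) ys" and "ys2 = drop (nlv t - 2 - length xs) ys"
    have ys: "ys = ys1 @ ys2" and len: "length xs + length ys1 + 2 = nlv t"
      using b Cons.prems(2) by (auto simp: ys1_def ys2_def)
    from lab_contr[OF 1 len] have *: "nf (lab (contr t (length xs)) (xs @ [u] @ ys1))
        = nf (lab t (xs @ [u @ [False], u @ [True]] @ ys1))"
      and **: "Suc (nlv (contr t (length xs))) = nlv t" by auto
    then have "nlv (contr t (length xs)) = length (xs @ [u] @ ys1)" using len by simp
    then have "labF (contrF (t # ts) (length xs)) (xs @ [u] @ ys) =
        lab (contr t (length xs)) (xs @ [u] @ ys1) # labF ts ys2"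
      using b by (simp add: ys)
    moreover have "labF (t # ts) (xs @ [u @ [False], u @ [True]] @ ys) =
        lab t (xs @ [u @ [False], u @ [True]] @ ys1) # labF ts ys2"
      using len[symmetric] by (simp add: ys)
    ultimately show ?thesis using * ** b by simp
  next
    case 2
    define xs1 xs2 where "xs1 = take (nlv t) xs" and "xs2 = drop (nlv t) xs"
    have xs: "xs = xs1 @ xs2" and len: "length xs1 = nlv t" "length xs2 = j"
      using 2 by (auto simp: xs1_def xs2_def)
    have "map nf (labF (contrF ts (length xs2)) (xs2 @ [u] @ ys)) = map nf (labF ts (xs2 @ [u @ [False], u @ [True]] @ ys))
       \<and> Suc (nlvF (contrF ts (length xs2))) = nlvF ts \<and> length (contrF ts (length xs2)) = length ts"
      using 2 len Cons.prems(2) by (intro Cons.IH) auto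
    then show ?thesis using 2 len by (simp add: xs)
  qed
qed simp

lemma dstep_wires:
  assumes "wfpic p" "dstep p q"
  shows "wfpic q" "map nf (wires_of q) = map nf (wires_of p)" "nlv (fst q) < nlv (fst p)"
    "length (snd q) = length (snd p)"
proof -
  obtain k where k: "k \<in> sib (fst p)" "k \<in> sibF (snd p)"
    and q: "q = (contr (fst p) k, contrF (snd p) k)" using assms by (auto simp: dstep_def)
  obtain xs u ys where l: "leafstrs (fst p) = xs @ [u @ [False], u @ [True]] @ ys" "length xs = k"
     "leafstrs (contr (fst p) k) = xs @ [u] @ ys" using leafstrs_contr[OF k(1)] by blast
  have n: "nlv (fst p) = length xs + length ys + 2" "nlv (contr (fst p) k) = length xs + length ys + 1"
    using l length_leafstrs[of "fst p"] length_leafstrs[of "contr (fst p) k"] by auto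
  then have "length xs + length ys + 2 = nlvF (snd p)" using assms(1) by (simp add: wfpic_def)
  from labF_contrF[OF _ this, of u] k l(2) n
  show "wfpic q" "map nf (wires_of q) = map nf (wires_of p)" "nlv (fst q) < nlv (fst p)"
    "length (snd q) = length (snd p)"
    unfolding q using assms(1) l by (auto simp: wires_of_def wfpic_def)
qed

lemma dsteps_wires:
  assumes "dstep\<^sup>*\<^sup>* p q" "wfpic p"
  shows "wfpic q \<and> map nf (wires_of q) = map nf (wires_of p)"
  using assms
proof (induction)
  case (step y z)
  then show ?case using dstep_wires[of y z] by metis
qed simp

lemma red_exists: "wfpic p \<Longrightarrow> \<exists>q. dstep\<^sup>*\<^sup>* p q \<and> reduced q"
proof (induction "nlv (fst p)" arbitrary: p rule: less_induct)
  case less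
  show ?case
  proof (cases "reduced p")
    case False
    then obtain q where "dstep p q" unfolding reduced_def dstep_def by blast
    then show ?thesis using less.hyps[of q] dstep_wires[OF less.prems]
      by (meson converse_rtranclp_into_rtranclp)
  qed blast
qed

text \<open>Every reduced picture reachable from \<open>p\<close> has the normal forms as its wires,
  and wires determine a vertex; this gives uniqueness. Existence holds because each removal lowers
  the number of leaves.\<close>

lemma red_wires:
  assumes "wfpic p"
  shows "red p \<in> Vert" "wires_of (red p) = map nf (wires_of p)"
proof -
  have *: "wires_of q = map nf (wires_of p) \<and> q \<in> Vert" if "dstep\<^sup>*\<^sup>* p q \<and> reduced q" for q
  proof -
    have q: "wfpic q" "map nf (wires_of q) = map nf (wires_of p)" using dsteps_wires[of p q] assms that by blast+
    then have "\<forall>w\<in>set (wires_of q). irr w" using that reduced_iff by blast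
    then have "map nf (wires_of q) = wires_of q" by (simp add: nf_irr map_idI)
    then show ?thesis using q that by (simp add: Vert_def)
  qed
  have "\<exists>!q. dstep\<^sup>*\<^sup>* p q \<and> reduced q"
    using red_exists[OF assms] * Vert_eqI by (metis (no_types, lifting))
  then have "dstep\<^sup>*\<^sup>* p (red p) \<and> reduced (red p)" unfolding red_def by (rule theI')
  from *[OF this] show "red p \<in> Vert" "wires_of (red p) = map nf (wires_of p)" by auto
qed

section \<open>The action of F on wires\<close>

fun tle :: "tr \<Rightarrow> tr \<Rightarrow> bool" where
  "tle Lf u \<longleftrightarrow> True"
| "tle (Nd a b) Lf \<longleftrightarrow> False"
| "tle (Nd a b) (Nd c d) \<longleftrightarrow> tle a c \<and> tle b d"

lemma tle_refl [simp]: "tle t t"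
  by (induction t) auto

lemma tle_join: "tle a (join a b)" "tle b (join a b)"
  by (induction a b rule: join.induct) auto

lemma length_ext [simp]: "tle t u \<Longrightarrow> length (ext t u) = nlv t"
  by (induction t u rule: tle.induct) auto

lemma nlvF_ext [simp]: "tle t u \<Longrightarrow> nlvF (ext t u) = nlv u"
  by (induction t u rule: tle.induct) auto

lemma graft_ext: "tle t u \<Longrightarrow> graft t (ext t u) = u"
  by (induction t u rule: tle.induct) auto

lemma nlvF_take_drop: "nlvF (take n xs) + nlvF (drop n xs) = nlvF xs"
  by (metis append_take_drop_id map_append sum_list_append)

lemma nlv_graft [simp]: "length xs = nlv t \<Longrightarrow> nlv (graft t xs) = nlvF xs"
proof (induction t arbitrary: xs)
  case Lf
  then show ?case by (cases xs) auto
qed (simp add: nlvF_take_drop)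

lemma nlvF_graftF [simp]: "length xs = nlvF ts \<Longrightarrow> nlvF (graftF ts xs) = nlvF xs"
  by (induction ts arbitrary: xs) (auto simp: nlvF_take_drop)

lemma take_labF: "take n (labF xs ss) = labF (take n xs) (take (nlvF (take n xs)) ss)"
  by (induction xs arbitrary: n ss) (auto simp: take_Cons' min_def drop_take)

lemma drop_labF: "drop n (labF xs ss) = labF (drop n xs) (drop (nlvF (take n xs)) ss)"
  by (induction xs arbitrary: n ss) (auto simp: take_Cons' drop_Cons' add.commute)

lemma labF_append: "labF (xs @ ys) ss = labF xs (take (nlvF xs) ss) @ labF ys (drop (nlvF xs) ss)"
  by (induction xs arbitrary: ss) (auto simp: min_def drop_take add.commute)

text \<open>The term operation of the algebra that the merge tree \<open>t\<close> denotes.\<close>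

fun ev :: "tr \<Rightarrow> wire list \<Rightarrow> wire" where
  "ev Lf vs = hd vs"
| "ev (Nd l r) vs = mk (ev l (take (nlv l) vs)) (ev r (drop (nlv l) vs))"

fun evF :: "tr list \<Rightarrow> wire list \<Rightarrow> wire list" where
  "evF [] vs = []"
| "evF (t # ts) vs = ev t (take (nlv t) vs) # evF ts (drop (nlv t) vs)"

lemma nf_lab: "length ss = nlv t \<Longrightarrow> nf (lab t ss) = ev t (map Str ss)"
proof (induction t arbitrary: ss)
  case Lf
  then show ?case by (cases ss) auto
qed (simp add: take_map drop_map)

lemma nf_lab_graft:
  "length xs = nlv t \<Longrightarrow> length ss = nlvF xs \<Longrightarrow> nf (lab (graft t xs) ss) = ev t (map nf (labF xs ss))"
proof (induction t arbitrary: xs ss)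
  case Lf
  then obtain x where "xs = [x]" by (cases xs) auto
  then show ?case using Lf by simp
next
  case (Nd l r)
  have "nlvF (take (nlv l) xs) \<le> nlvF xs" using nlvF_take_drop[of "nlv l" xs] by linarith
  then show ?case using Nd nlvF_take_drop[of "nlv l" xs]
    by (simp add: take_map drop_map take_labF drop_labF)
qed

lemma nf_labF_graftF:
  "length xs = nlvF ts \<Longrightarrow> length ss = nlvF xs \<Longrightarrow>
    map nf (labF (graftF ts xs) ss) = evF ts (map nf (labF xs ss))"
proof (induction ts arbitrary: xs ss)
  case (Cons t ts)
  have "nlvF (take (nlv t) xs) \<le> nlvF xs" using nlvF_take_drop[of "nlv t" xs] by linarith
  then show ?case using Cons nlvF_take_drop[of "nlv t" xs]
    by (simp add: take_map drop_map take_labF drop_labF nf_lab_graft)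
qed simp

lemma subst_lab: "length ss = nlv f \<Longrightarrow> subst t (lab f ss) = ev f (map (\<lambda>s. desc s t) ss)"
proof (induction f arbitrary: ss)
  case Lf
  then show ?case by (cases ss) auto
qed (simp add: take_map drop_map)

lemma subst_labF: "length ss = nlvF ts \<Longrightarrow> map (subst t) (labF ts ss) = evF ts (map (\<lambda>s. desc s t) ss)"
  by (induction ts arbitrary: ss) (simp_all add: take_map drop_map subst_lab)

text \<open>Cutting \<open>w\<close> at the leaves of \<open>t\<close> produces the subwires at the
  addresses \<open>leafstrs t\<close>, because normalising commutes with the projections.\<close>

lemma nf_labF_ext:
  "tle t (shape w) \<Longrightarrow> map nf (labF (ext t (shape w)) (labels w)) = map (\<lambda>s. desc s (nf w)) (leafstrs t)"
proof (induction t arbitrary: w)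
  case (Nd l r)
  then obtain a b where w: "w = Mrg a b" by (cases w) auto
  have "tle l (shape a)" "tle r (shape b)" using Nd.prems w by auto
  then show ?case using Nd.IH by (simp add: w labF_append)
qed simp

text \<open>A tree of carets followed by its mirror image cancels completely, innermost dipoles
  first.\<close>

lemma nf_lab_leafstrs: "nf (lab t (map ((@) a) (leafstrs t))) = Str a"
proof (induction t arbitrary: a)
  case (Nd l r)
  have 1: "map ((@) a) (leafstrs (Nd l r)) =
      map ((@) (a @ [False])) (leafstrs l) @ map ((@) (a @ [True])) (leafstrs r)" by simp
  have 2: "nf (lab (Nd l r) (xs @ ys)) = mk (nf (lab l xs)) (nf (lab r ys))" if "length xs = nlv l" for xs ys
    using that by simp
  have "nf (lab (Nd l r) (map ((@) a) (leafstrs (Nd l r)))) =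
      mk (nf (lab l (map ((@) (a @ [False])) (leafstrs l)))) (nf (lab r (map ((@) (a @ [True])) (leafstrs r))))"
    unfolding 1 by (rule 2) simp
  then show ?case unfolding Nd by simp
qed simp

lemma leafstrs_graft:
  "length xs = nlv f \<Longrightarrow>
    leafstrs (graft f xs) = concat (map2 (\<lambda>a x. map ((@) a) (leafstrs x)) (leafstrs f) xs)"
proof (induction f arbitrary: xs)
  case Lf
  then show ?case by (cases xs) (auto intro: map_idI[symmetric])
next
  case (Nd l r)
  have xs: "xs = take (nlv l) xs @ drop (nlv l) xs" by simp
  have z: "zip (as @ bs) xs = zip as (take (nlv l) xs) @ zip bs (drop (nlv l) xs)"
    if "length as = nlv l" for as bs :: "bool list list"
    by (simp add: that zip_append1)
  have c: "(@) (c # a) = (\<lambda>b. c # a @ b)" for c and a :: "bool list" by auto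
  have *: "concat (map2 (\<lambda>a x. map ((@) a) (leafstrs x)) (map (Cons c) as) ys)
     = map (Cons c) (concat (map2 (\<lambda>a x. map ((@) a) (leafstrs x)) as ys))" for c as ys
    by (simp add: zip_map1 map_concat comp_def case_prod_unfold c)
  show ?case using Nd by (simp add: z *)
qed

lemma nf_labF_expand:
  "length as = length xs \<Longrightarrow>
    map nf (labF xs (concat (map2 (\<lambda>a x. map ((@) a) (leafstrs x)) as xs))) = map Str as"
  by (induction as xs rule: list_induct2) (simp_all add: nf_lab_leafstrs)

text \<open>The common refinement \<open>U\<close> is cut in two ways, along \<open>B\<close> and
  along the caret tree of \<open>v\<close>; the first computes one wire, the second distributes its
  subwires over the forest of \<open>v\<close>.\<close>

lemma cat_wires:
  assumes "wfpic v" "nlv A = nlv B"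
  shows "wfpic (cat (A, [B]) v)"
    "map nf (wires_of (cat (A, [B]) v)) = map (subst (nf (lab B (leafstrs A)))) (wires_of v)"
proof -
  obtain T Fs where v: "v = (T, Fs)" by fastforce
  define U where "U = join B T"
  have U: "tle B U" "tle T U" using tle_join by (auto simp: U_def)
  have c: "cat (A, [B]) v = (graft A (ext B U), graftF Fs (ext T U))"
    by (simp add: cat_def v U_def Let_def)
  have T: "nlv T = nlvF Fs" using assms(1) by (simp add: v wfpic_def)
  then show "wfpic (cat (A, [B]) v)" using U assms(2) by (simp add: c wfpic_def)
  define ss where "ss = leafstrs (graft A (ext B U))"
  have len: "length ss = nlv U" using U assms(2) by (simp add: ss_def)
  \<comment> \<open>An auxiliary wire: all of \<open>U\<close> turned into merges below the carets
    of the concatenation.\<close>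
  define w where "w = lab U ss"
  have w: "shape w = U" "labels w = ss" by (simp_all add: w_def labels_lab len)
  have "nf w = nf (lab (graft B (ext B U)) ss)" by (simp add: w_def graft_ext U)
  also have "\<dots> = ev B (map nf (labF (ext B U) ss))"
    using U len by (simp add: nf_lab_graft)
  \<comment> \<open>Cut along \<open>B\<close>: the carets grafted below each leaf of
    \<open>A\<close> meet their own mirror image.\<close>
  also have "map nf (labF (ext B U) ss) = map Str (leafstrs A)"
    using U assms(2) by (simp add: ss_def leafstrs_graft nf_labF_expand)
  also have "ev B \<dots> = nf (lab B (leafstrs A))" using assms(2) by (simp add: nf_lab)
  finally have nfw: "nf w = nf (lab B (leafstrs A))" .
  have "map nf (wires_of (cat (A, [B]) v)) = map nf (labF (graftF Fs (ext T U)) ss)"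
    by (simp add: wires_of_def c ss_def)
  also have "\<dots> = evF Fs (map nf (labF (ext T U) ss))"
    using U T len by (simp add: nf_labF_graftF)
  \<comment> \<open>Cut along \<open>T\<close>: the pieces are exactly what \<open>subst\<close>
    writes at the leaf strings of \<open>T\<close>.\<close>
  also have "map nf (labF (ext T U) ss) = map (\<lambda>s. desc s (nf w)) (leafstrs T)"
    using nf_labF_ext[of T w] U w by simp
  also have "evF Fs \<dots> = map (subst (nf w)) (wires_of v)"
    using T by (simp add: subst_labF wires_of_def v)
  finally show "map nf (wires_of (cat (A, [B]) v)) = map (subst (nf (lab B (leafstrs A)))) (wires_of v)"
    unfolding nfw .
qed

definition root_image :: "pic \<Rightarrow> wire" where
  "root_image g = hd (wires_of g)"

text \<open>The picture turned upside down: carets become merges and conversely.\<close>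

definition inverse_pic :: "pic \<Rightarrow> pic" where
  "inverse_pic g = (hd (snd g), [fst g])"

lemma ThompsonF_obtain:
  assumes "g \<in> ThompsonF"
  obtains A B where "g = (A, [B])" "nlv A = nlv B" "root_image g = lab B (leafstrs A)" "irr (lab B (leafstrs A))"
proof -
  obtain A B where g: "g = (A, [B])"
    using assms by (cases g) (auto simp: ThompsonF_def length_Suc_conv)
  then have "nlv A = nlv B" "root_image g = lab B (leafstrs A)" "irr (lab B (leafstrs A))"
    using assms by (auto simp: ThompsonF_def Vert_iff wfpic_def wires_of_def root_image_def)
  with g that show ?thesis by blast
qed

lemma irr_root_image: "g \<in> ThompsonF \<Longrightarrow> irr (root_image g)"
  by (metis ThompsonF_obtain)

lemma act_wires:
  assumes "g \<in> ThompsonF" "v \<in> Vert"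
  shows "act g v \<in> Vert" "wires_of (act g v) = map (subst (root_image g)) (wires_of v)"
proof -
  obtain A B where g: "g = (A, [B])" "nlv A = nlv B" "root_image g = lab B (leafstrs A)" "irr (lab B (leafstrs A))"
    using ThompsonF_obtain[OF assms(1)] by blast
  have "wfpic v" using assms by (simp add: Vert_def)
  note c = cat_wires[OF this g(2)]
  show "act g v \<in> Vert" "wires_of (act g v) = map (subst (root_image g)) (wires_of v)"
    using red_wires[OF c(1)] c(2) g by (simp_all add: act_def nf_irr)
qed

lemma inverse_pic_ThompsonF: "g \<in> ThompsonF \<Longrightarrow> inverse_pic g \<in> ThompsonF"
  by (auto simp: ThompsonF_def inverse_pic_def Vert_def wfpic_def reduced_def length_Suc_conv)

lemma inverse_pic_inverse_pic: "g \<in> ThompsonF \<Longrightarrow> inverse_pic (inverse_pic g) = g"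
  by (metis ThompsonF_obtain fst_conv list.sel(1) snd_conv inverse_pic_def)

lemma desc_lab:
  "length ss = nlv t \<Longrightarrow> map (\<lambda>s. desc s (lab t ss)) (leafstrs t) = map Str ss"
proof (induction t arbitrary: ss)
  case Lf
  then show ?case by (cases ss) auto
next
  case (Nd l r)
  have "map (\<lambda>s. desc s (lab (Nd l r) ss)) (leafstrs (Nd l r)) = map Str (take (nlv l) ss) @ map Str (drop (nlv l) ss)"
    using Nd.IH(1)[of "take (nlv l) ss"] Nd.IH(2)[of "drop (nlv l) ss"] Nd.prems by (simp add: comp_def)
  then show ?case by (metis append_take_drop_id map_append)
qed

text \<open>Descending in \<open>B\<close> along its own leaf strings returns the strings of
  \<open>A\<close>; then \<open>A\<close> is merged over its own leaves and collapses.\<close>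

lemma subst_root_image_inverse_pic:
  assumes "g \<in> ThompsonF"
  shows "subst (root_image g) (root_image (inverse_pic g)) = Str []"
proof -
  obtain A B where g: "g = (A, [B])" "nlv A = nlv B" "root_image g = lab B (leafstrs A)"
    using ThompsonF_obtain[OF assms(1)] by blast
  have "root_image (inverse_pic g) = lab A (leafstrs B)" by (simp add: g inverse_pic_def root_image_def wires_of_def)
  then show ?thesis using g nf_lab_leafstrs[of A "[]"] by (simp add: subst_lab desc_lab nf_lab map_idI)
qed

lemma subst_inverse_pic:
  assumes "g \<in> ThompsonF" "irr x"
  shows "subst (root_image g) (subst (root_image (inverse_pic g)) x) = x"
    and "subst (root_image (inverse_pic g)) (subst (root_image g) x) = x"
proof -
  have *: "subst (root_image g) (subst (root_image (inverse_pic g)) x) = x" if "g \<in> ThompsonF" for g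
    using that assms(2) by (simp add: subst_subst irr_root_image subst_root_image_inverse_pic subst_id)
  show "subst (root_image g) (subst (root_image (inverse_pic g)) x) = x" using * assms(1) by blast
  show "subst (root_image (inverse_pic g)) (subst (root_image g) x) = x"
    using *[of "inverse_pic g"] assms(1) by (simp add: inverse_pic_inverse_pic inverse_pic_ThompsonF)
qed

lemma act_inverse_pic: 
  assumes "g \<in> ThompsonF" "v \<in> Vert"
  shows "act g (act (inverse_pic g) v) = v" "act (inverse_pic g) (act g v) = v"
proof -
  have "\<forall>w\<in>set (wires_of v). irr w" using assms Vert_iff by blast
  then have "map (subst (root_image g)) (map (subst (root_image (inverse_pic g))) (wires_of v)) = wires_of v"
    "map (subst (root_image (inverse_pic g))) (map (subst (root_image g)) (wires_of v)) = wires_of v"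
    using subst_inverse_pic[OF assms(1)] by (simp_all add: map_idI)
  then show "act g (act (inverse_pic g) v) = v" "act (inverse_pic g) (act g v) = v"
    using assms by (auto intro!: Vert_eqI simp: act_wires inverse_pic_ThompsonF)
qed

section \<open>The event structure of transistors\<close>

text \<open>A transistor is named by a wire: \<open>Str s\<close> stands for the caret splitting the wire \<open>s\<close>, and
\<open>Mrg a b\<close> for the merge producing that wire.\<close>
fun evs :: "wire \<Rightarrow> wire set" where
  "evs (Str l) = {Str s | s. strict_prefix s l}"
| "evs (Mrg a b) = insert (Mrg a b) (evs a \<union> evs b)"

definition events :: "wire list \<Rightarrow> wire set" where
  "events ws = (\<Union>w\<in>set ws. evs w)"

text \<open>The wire \<open>Str s\<close> exists once the carets strictly above \<open>s\<close> are
  present (\<open>evs\<close>); the caret \<open>Str s\<close> also counts itself, hence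
  \<open>prefix\<close> here. A merge bears the name of its output wire, so for it both notions
  agree.\<close>

fun down :: "wire \<Rightarrow> wire set" where
  "down (Str s) = {Str p | p. prefix p s}"
| "down (Mrg a b) = evs (Mrg a b)"

text \<open>A rank that strictly increases along the order of transistors; it gives antisymmetry
  here and the bound on irregular transistors later.\<close>

fun msize :: "wire \<Rightarrow> nat" where
  "msize (Str s) = length s"
| "msize (Mrg a b) = Suc (msize a + msize b)"

definition downset :: "wire set \<Rightarrow> bool" where
  "downset X \<longleftrightarrow> (\<forall>e\<in>X. down e \<subseteq> X)"

inductive extends :: "wire list \<Rightarrow> wire \<Rightarrow> wire list \<Rightarrow> bool" where
  split: "extends (xs @ [Str s] @ ys) (Str s) (xs @ [Str (s @ [False]), Str (s @ [True])] @ ys)"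
| merge: "irr (Mrg a b) \<Longrightarrow> extends (xs @ [a, b] @ ys) (Mrg a b) (xs @ [Mrg a b] @ ys)"

lemma events_simps [simp]:
  "events [] = {}" "events (w # ws) = evs w \<union> events ws" "events (xs @ ys) = events xs \<union> events ys"
  by (auto simp: events_def)

lemma self_in_down [simp]: "e \<in> down e"
  by (cases e) auto

lemma Str_in_evs: "Str s \<in> evs w \<longleftrightarrow> (\<exists>l\<in>set (labels w). strict_prefix s l)"
  by (induction w) auto

lemma Str_in_events: "Str s \<in> events ws \<longleftrightarrow> (\<exists>l\<in>set (labelsF ws). strict_prefix s l)"
  by (auto simp: events_def Str_in_evs)

lemma labels_Mrg_in_evs: "Mrg a b \<in> evs w \<Longrightarrow> set (labels (Mrg a b)) \<subseteq> set (labels w)"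
  by (induction w) auto

lemma Mrg_in_evs_trans: "Mrg a b \<in> evs w \<Longrightarrow> evs (Mrg a b) \<subseteq> evs w"
  by (induction w) auto

lemma down_evs: "e \<in> evs w \<Longrightarrow> down e \<subseteq> evs w"
proof (cases e)
  case (Str s)
  assume "e \<in> evs w"
  then show ?thesis
    unfolding Str using prefix_order.le_less_trans by (fastforce simp: Str_in_evs)
next
  case (Mrg a b)
  assume "e \<in> evs w"
  then show ?thesis using Mrg_in_evs_trans[of a b w] Mrg by simp
qed

lemma downset_events: "downset (events ws)"
  using down_evs by (fastforce simp: downset_def events_def)

lemma downset_down: "downset (down e)"
proof (cases e)
  case (Str s)
  then show ?thesis using prefix_order.trans by (fastforce simp: downset_def)
next
  case (Mrg a b)
  then show ?thesis using down_evs by (auto simp: downset_def)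
qed

lemma msize_evs: "f \<in> evs w \<Longrightarrow> msize f \<le> msize w \<and> (f \<noteq> w \<longrightarrow> msize f < msize w)"
  by (induction w) (auto simp: prefix_length_less less_imp_le)

lemma msize_down: "f \<in> down e \<Longrightarrow> f \<noteq> e \<Longrightarrow> msize f < msize e"
proof (cases e)
  case (Str s)
  moreover assume "f \<in> down e" "f \<noteq> e"
  ultimately show ?thesis by (auto simp: strict_prefix_def intro!: prefix_length_less)
next
  case (Mrg a b)
  moreover assume "f \<in> down e" "f \<noteq> e"
  ultimately show ?thesis using msize_evs[of f e] by simp
qed

lemma down_antisym: "f \<in> down e \<Longrightarrow> e \<in> down f \<Longrightarrow> e = f"
  using msize_down by (metis less_asym)

lemma downset_down_less: "downset (down e - {e})"
  using downset_down down_antisym by (fastforce simp: downset_def)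

lemma down_trans: "f \<in> down e \<Longrightarrow> down f \<subseteq> down e"
  using downset_down by (auto simp: downset_def)

lemma finite_evs: "finite (evs w)"
proof (induction w)
  case (Str l)
  have "evs (Str l) \<subseteq> Str ` set (prefixes l)" by (auto simp: in_set_prefixes prefix_order.less_imp_le)
  then show ?case using finite_subset by blast
qed auto

lemma finite_events: "finite (events ws)"
  by (auto simp: events_def finite_evs)

section \<open>Configurations are determined by their transistors\<close>

lemma Conf_distinct: "ws \<in> Conf \<Longrightarrow> distinct (labelsF ws)"
  by (auto simp: Conf_def distinct_leafstrs)

lemma Conf_antichain:
  "ws \<in> Conf \<Longrightarrow> s \<in> set (labelsF ws) \<Longrightarrow> s' \<in> set (labelsF ws) \<Longrightarrow> prefix s s' \<Longrightarrow> s = s'"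
  unfolding Conf_def using leafstrs_antichain by fastforce

lemma range_leafstrs_split:
  "xs @ [u] @ ys \<in> range leafstrs \<longleftrightarrow> xs @ [u @ [False], u @ [True]] @ ys \<in> range leafstrs"
proof
  assume "xs @ [u] @ ys \<in> range leafstrs"
  then obtain t where "leafstrs t = xs @ [u] @ ys" by (metis imageE)
  from leafstrs_splitAt[OF this] show "xs @ [u @ [False], u @ [True]] @ ys \<in> range leafstrs" by (metis rangeI)
next
  assume "xs @ [u @ [False], u @ [True]] @ ys \<in> range leafstrs"
  then obtain t where t: "leafstrs t = xs @ [u @ [False], u @ [True]] @ ys" by (metis imageE)
  then have "length xs \<in> sib t"
    using length_leafstrs[of t] by (simp add: sib_iff nth_append)
  from leafstrs_contr[OF this] show "xs @ [u] @ ys \<in> range leafstrs"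
    using t by (auto simp: append_eq_append_conv intro: range_eqI[OF sym])
qed

lemma extends_Conf: "extends ws e ws' \<Longrightarrow> ws \<in> Conf \<longleftrightarrow> ws' \<in> Conf"
proof (induction rule: extends.induct)
  case (split xs s ys)
  then show ?case using range_leafstrs_split[of "labelsF xs" s "labelsF ys"] by (auto simp: Conf_def)
qed (auto simp: Conf_def)

lemma extends_events: "extends ws e ws' \<Longrightarrow> events ws' = insert e (events ws)"
proof (induction rule: extends.induct)
  case (split xs s ys)
  then show ?case by (auto simp: prefix_order.less_le)
qed auto

text \<open>A split string is a leaf, so by the antichain property no leaf lies strictly below it. A
  merge already present would put labels of both \<open>a\<close> and \<open>b\<close> on one wire,
  although distinct wires have disjoint labels.\<close>

lemma extends_notin: "extends ws e ws' \<Longrightarrow> ws \<in> Conf \<Longrightarrow> e \<notin> events ws"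
proof (induction rule: extends.induct)
  case (split xs s ys)
  then show ?case
    unfolding Str_in_events using Conf_antichain[OF split, of s] by (auto simp: prefix_order.less_le)
next
  case (merge a b xs ys)
  show ?case
  proof
    assume "Mrg a b \<in> events (xs @ [a, b] @ ys)"
    then obtain w where w: "w \<in> set (xs @ [a, b] @ ys)" "Mrg a b \<in> evs w" by (auto simp: events_def)
    then have "set (labels a) \<union> set (labels b) \<subseteq> set (labels w)" using labels_Mrg_in_evs[OF w(2)] by simp
    moreover obtain la lb where "la \<in> set (labels a)" "lb \<in> set (labels b)" using labels_nonempty hd_in_set by metis
    ultimately have l: "la \<in> set (labels a)" "lb \<in> set (labels b)" "la \<in> set (labels w)" "lb \<in> set (labels w)" by auto
    have "set (labels a) \<inter> set (labels b) = {}" "\<forall>w\<in>set xs \<union> set ys. set (labels a) \<inter> set (labels w) = {}"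
      using Conf_distinct[OF merge(2)] by auto
    moreover have "w \<in> set xs \<union> set ys \<or> w = a \<or> w = b" using w(1) by auto
    ultimately show False using l by blast
  qed
qed

lemma strict_prefix_snoc: "strict_prefix s l \<longleftrightarrow> (\<exists>c. prefix (s @ [c]) l)"
  by (auto elim!: strict_prefixE' simp: prefix_def) (simp add: strict_prefix_def)

lemma leaf_siblings:
  "s @ [False] \<in> set (leafstrs t) \<Longrightarrow> s @ [True] \<in> set (leafstrs t) \<Longrightarrow>
    \<exists>xs ys. leafstrs t = xs @ [s @ [False], s @ [True]] @ ys"
proof (induction t arbitrary: s)
  case (Nd l r)
  show ?case
  proof (cases s)
    case Nil
    then have "l = Lf" "r = Lf" using Nd.prems by auto
    then show ?thesis using Nil by (intro exI[of _ "[]"]) auto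
  next
    case (Cons c s')
    show ?thesis
    proof (cases c)
      case True
      then obtain xs ys where "leafstrs r = xs @ [s' @ [False], s' @ [True]] @ ys"
        using Nd.IH(2)[of s'] Nd.prems Cons by auto
      then have "leafstrs (Nd l r) =
          (map (Cons False) (leafstrs l) @ map (Cons True) xs) @ [s @ [False], s @ [True]] @ map (Cons True) ys"
        using Cons True by simp
      then show ?thesis by blast
    next
      case False
      then obtain xs ys where "leafstrs l = xs @ [s' @ [False], s' @ [True]] @ ys"
        using Nd.IH(1)[of s'] Nd.prems Cons by auto
      then have "leafstrs (Nd l r) =
          map (Cons False) xs @ [s @ [False], s @ [True]] @ map (Cons False) ys @ map (Cons True) (leafstrs r)"
        using Cons False by simp
      then show ?thesis by blast
    qed
  qed
qed simp

lemma Conf_same_wire: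
  assumes "ws \<in> Conf" "x \<in> set ws" "y \<in> set ws" "l \<in> set (labels x)" "l \<in> set (labels y)"
  shows "x = y"
proof -
  obtain us vs where "ws = us @ x # vs" using assms by (metis split_list)
  then show ?thesis using Conf_distinct[OF assms(1)] assms by auto
qed

text \<open>Peels off a maximal transistor without touching \<open>X\<close>. If a bottom wire is a
  merge outside \<open>X\<close>, it is undone. Otherwise the downset \<open>X\<close> contains
  everything above the merged wires, so what lies outside \<open>X\<close> sits above plain strings,
  and a longest caret among it has both bottom wires free.\<close>

lemma removal:
  assumes ws: "ws \<in> Conf" and X: "downset X" and ne: "\<not> events ws \<subseteq> X"
  obtains us e where "extends us e ws" "e \<notin> X" "us \<in> Conf"
proof (cases "\<exists>a b. Mrg a b \<in> set ws \<and> Mrg a b \<notin> X")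
  case True
  then obtain a b xs ys where e: "ws = xs @ [Mrg a b] @ ys" "Mrg a b \<notin> X"
    by (metis append_Cons append_Nil split_list)
  moreover have "irr (Mrg a b)" using ws e by (auto simp: Conf_def)
  ultimately have "extends (xs @ [a, b] @ ys) (Mrg a b) ws" using extends.merge by (metis append_Cons append_Nil)
  then show ?thesis using that e ws extends_Conf by blast
next
  case False
  have evsX: "w \<in> set ws \<Longrightarrow> e \<in> evs w \<Longrightarrow> e \<notin> X \<Longrightarrow> \<exists>l. w = Str l" for w e
    using False X unfolding downset_def by (cases w) force+
  obtain e where e: "e \<in> events ws" "e \<notin> X" using ne by blast
  define Y where "Y = {s. Str s \<in> events ws \<and> Str s \<notin> X}"
  obtain w where w: "w \<in> set ws" "e \<in> evs w" using e by (auto simp: events_def)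
  then obtain l where "w = Str l" using e evsX by blast
  then have "Y \<noteq> {}" using e w by (auto simp: Y_def)
  moreover have "finite Y"
    using finite_imageD[of Str Y] finite_subset[OF _ finite_events[of ws], of "Str ` Y"]
    by (auto simp: Y_def inj_on_def)
  ultimately obtain s where "s \<in> Y" "length s = Max (length ` Y)"
    by (metis Max_in finite_imageI image_is_empty imageE)
  then have s: "s \<in> Y" "\<And>s'. s' \<in> Y \<Longrightarrow> length s' \<le> length s"
    using \<open>finite Y\<close> by auto
  obtain T where T: "labelsF ws = leafstrs T" using ws by (auto simp: Conf_def)
  \<comment> \<open>A caret at \<open>s @ [c]\<close> is longer than \<open>s\<close>, hence would
    lie in \<open>X\<close> and pull \<open>Str s\<close> into the downset. So
    \<open>s @ [c]\<close> is a leaf, and \<open>evsX\<close> shows that it is not merged, as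
    \<open>Str s\<close> above it is outside \<open>X\<close>.\<close>
  have sub: "Str (s @ [c]) \<in> set ws" for c
  proof -
    from s obtain l c' where "l \<in> set (leafstrs T)" "prefix (s @ [c']) l"
      by (auto simp: Y_def Str_in_events T strict_prefix_snoc)
    from strict_prefix_leafD[OF this] obtain l where l: "l \<in> set (leafstrs T)" "prefix (s @ [c]) l" by blast
    have "Str (s @ [c]) \<notin> events ws"
    proof
      assume "Str (s @ [c]) \<in> events ws"
      then have "Str (s @ [c]) \<in> X" using s(2)[of "s @ [c]"] by (auto simp: Y_def)
      then have "Str s \<in> X" using X by (force simp: downset_def)
      then show False using s by (simp add: Y_def)
    qed
    then have "l = s @ [c]" using l by (auto simp: Str_in_events T prefix_order.less_le)
    then have "s @ [c] \<in> set (labelsF ws)" unfolding T using l by simp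
    then obtain w where w: "w \<in> set ws" "s @ [c] \<in> set (labels w)" by auto
    then have "Str s \<in> evs w" by (auto simp: Str_in_evs strict_prefix_def intro!: bexI[of _ "s @ [c]"])
    then obtain l' where "w = Str l'" using evsX w(1) s by (auto simp: Y_def)
    then show ?thesis using w by auto
  qed
  \<comment> \<open>Both children are bottom wires; that they are neighbours in \<open>ws\<close> is
    read off from the list of leaf strings.\<close>
  obtain xs ys where ws1: "ws = xs @ Str (s @ [False]) # ys" using sub by (metis split_list)
  have "s @ [c] \<in> set (leafstrs T)" for c unfolding T[symmetric] using sub[of c] by force
  then obtain L R where LR: "leafstrs T = L @ [s @ [False], s @ [True]] @ R" using leaf_siblings by metis
  have "labelsF xs @ (s @ [False]) # labelsF ys = L @ (s @ [False]) # (s @ [True]) # R"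
    using LR T ws1 by simp
  moreover have "distinct (labelsF xs @ (s @ [False]) # labelsF ys)" using Conf_distinct[OF ws] ws1 by simp
  then have "s @ [False] \<notin> set (labelsF xs)" "s @ [False] \<notin> set (labelsF ys)" by simp_all
  ultimately have ysR: "labelsF ys = (s @ [True]) # R"
    using append_Cons_eq_iff by metis
  then obtain y ys' where ys: "ys = y # ys'" by (cases ys) auto
  then have "s @ [True] \<in> set (labels y)" using ysR by (cases "labels y") auto
  then have "y = Str (s @ [True])" using Conf_same_wire[OF ws _ sub, of y] ws1 ys by auto
  then have "\<exists>ys'. ys = Str (s @ [True]) # ys'" using ys by blast
  then obtain ys' where "ws = xs @ [Str (s @ [False]), Str (s @ [True])] @ ys'" using ws1 by auto
  then have "extends (xs @ [Str s] @ ys') (Str s) ws" using extends.split by metis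
  then show ?thesis using that ws extends_Conf s by (metis (mono_tags, lifting) Y_def mem_Collect_eq)
qed

text \<open>Labels fix the order from left to right: only one wire carries the first label.\<close>

lemma concat_labels_eq:
  assumes "labelsF xs = labelsF ys" "set xs = set ys" "distinct (labelsF xs)"
  shows "xs = ys"
  using assms
proof (induction xs arbitrary: ys)
  case (Cons x xs)
  then obtain y ys' where ys: "ys = y # ys'" by (cases ys) auto
  have hd: "hd (labels x) = hd (labels y)"
    using Cons.prems(1) by (metis concat.simps(2) hd_append2 labels_nonempty list.simps(9) ys)
  have notin: "x \<notin> set xs" if "distinct (labelsF (x # xs))" for x xs
  proof -
    obtain l where "l \<in> set (labels x)" using hd_in_set labels_nonempty by metis
    then show ?thesis using that by (auto simp: disjoint_iff)
  qed
  have "x = y"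
  proof (rule ccontr)
    assume "x \<noteq> y"
    then have "x \<in> set ys'" using Cons.prems(2) ys by auto
    then have "hd (labels y) \<in> set (labelsF ys')" using hd hd_in_set[OF labels_nonempty[of x]] by auto
    then obtain l where l: "l \<in> set (labels y)" "l \<in> set (labelsF ys')"
      using hd_in_set[OF labels_nonempty] by blast
    have "distinct (labelsF ys)" using Cons.prems by simp
    then have "set (labels y) \<inter> set (labelsF ys') = {}" unfolding ys by simp
    then show False using l by blast
  qed
  moreover have "xs = ys'"
  proof (rule Cons.IH)
    have "x \<notin> set xs" "y \<notin> set ys'" using notin Cons.prems ys by metis+
    then show "set xs = set ys'" using Cons.prems(2) ys \<open>x = y\<close> by auto
  qed (use Cons.prems ys \<open>x = y\<close> in auto)
  ultimately show ?case using ys by simp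
qed simp

lemma evs_Mrg_antisym: "Mrg a b \<in> evs (Mrg c d) \<Longrightarrow> Mrg c d \<in> evs (Mrg a b) \<Longrightarrow> Mrg a b = Mrg c d"
  using down_antisym[of "Mrg a b" "Mrg c d"] by simp

lemma Nil_caret: "\<exists>l\<in>set (leafstrs (Nd a b)). strict_prefix [] l"
proof -
  obtain x where "x \<in> set (leafstrs a)" using hd_in_set leafstrs_nonempty by blast
  then have "False # x \<in> set (leafstrs (Nd a b))" by simp
  then show ?thesis by (metis strict_prefix_simps(2))
qed

lemma carets_inject:
  "{s. \<exists>l\<in>set (leafstrs t). strict_prefix s l} = {s. \<exists>l\<in>set (leafstrs u). strict_prefix s l} \<Longrightarrow> t = u"
proof (induction t arbitrary: u)
  case Lf
  then have none: "\<not> (\<exists>l\<in>set (leafstrs u). strict_prefix [] l)" by auto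
  show ?case
  proof (cases u)
    case (Nd a b)
    then show ?thesis using none Nil_caret by blast
  qed simp
next
  case (Nd l r)
  have sub: "{s. c # s \<in> {s. \<exists>l\<in>set (leafstrs (Nd a b)). strict_prefix s l}} =
     {s. \<exists>l\<in>set (leafstrs (if c then b else a)). strict_prefix s l}" for a b c
    by (cases c) (auto simp: bex_Un)
  have some: "\<exists>l\<in>set (leafstrs u). strict_prefix [] l" using Nd.prems Nil_caret by blast
  obtain l' r' where u: "u = Nd l' r'"
  proof (cases u)
    case Lf
    then show thesis using some by simp
  qed (use that in blast)
  have "{s. \<exists>x\<in>set (leafstrs (if c then r else l)). strict_prefix s x} =
      {s. \<exists>x\<in>set (leafstrs (if c then r' else l')). strict_prefix s x}" for c
    unfolding sub[symmetric] Nd.prems[unfolded u] ..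
  from this[of False] this[of True] show ?case
    using Nd.IH(1)[of l'] Nd.IH(2)[of r'] by (simp add: u)
qed

text \<open>A merge of \<open>ws'\<close> that covers \<open>x\<close> is also an event of
  \<open>ws\<close>, on a wire sharing a label with \<open>x\<close>, hence on \<open>x\<close>
  itself. That is impossible for a string and forces equality for a merge.\<close>

lemma Conf_events_subset:
  assumes "ws \<in> Conf" "ws' \<in> Conf" "events ws = events ws'" "labelsF ws = labelsF ws'" "x \<in> set ws"
  shows "x \<in> set ws'"
proof (cases x)
  case (Str s)
  then have "s \<in> set (labelsF ws')" unfolding assms(4)[symmetric] using assms(5) by force
  then obtain y where y: "y \<in> set ws'" "s \<in> set (labels y)" by auto
  show ?thesis
  proof (cases y)
    case (Mrg a b)
    then have "y \<in> events ws'" using y by (auto simp: events_def intro!: bexI[of _ y])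
    then have "y \<in> events ws" using assms(3) by simp
    then obtain z where z: "z \<in> set ws" "y \<in> evs z" by (auto simp: events_def)
    then have "s \<in> set (labels z)" using labels_Mrg_in_evs y(2) Mrg by blast
    then have "z = x" using Conf_same_wire assms(1,5) z(1) Str by fastforce
    then show ?thesis using z Str Mrg by simp
  qed (use y Str in auto)
next
  case (Mrg a b)
  have "x \<in> events ws'" using Mrg assms(3,5) by (force simp: events_def)
  then obtain y where y: "y \<in> set ws'" "x \<in> evs y" by (auto simp: events_def)
  have "\<exists>c d. y = Mrg c d" using y(2) Mrg by (cases y) auto
  then obtain c d where cd: "y = Mrg c d" by blast
  then have "y \<in> events ws'" using y(1) by (auto simp: events_def intro!: bexI[of _ y])
  then have "y \<in> events ws" using assms(3) by simp
  then obtain z where z: "z \<in> set ws" "y \<in> evs z" by (auto simp: events_def)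
  have "set (labels x) \<subseteq> set (labels z)" using labels_Mrg_in_evs y z Mrg cd by blast
  then have "z = x" using Conf_same_wire[OF assms(1) z(1) assms(5)] hd_in_set[OF labels_nonempty[of x]] by blast
  then have "y = x" using evs_Mrg_antisym y(2) z(2) Mrg cd by blast
  then show ?thesis using y by simp
qed

text \<open>The carets give the tree, hence the labels; the merges then give the set of wires, and
  the labels their order.\<close>

lemma Conf_events_inject:
  assumes "ws \<in> Conf" "ws' \<in> Conf" "events ws = events ws'"
  shows "ws = ws'"
proof -
  obtain T T' where T: "labelsF ws = leafstrs T" "labelsF ws' = leafstrs T'" using assms by (auto simp: Conf_def)
  have "{s. \<exists>l\<in>set (leafstrs T). strict_prefix s l} = {s. \<exists>l\<in>set (leafstrs T'). strict_prefix s l}"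
    unfolding T[symmetric] Str_in_events[symmetric] assms(3) ..
  then have "T = T'" by (rule carets_inject)
  then have eq: "labelsF ws = labelsF ws'" using T by simp
  have "set ws = set ws'"
    using Conf_events_subset[of ws ws'] Conf_events_subset[of ws' ws] assms eq by auto
  then show ?thesis using concat_labels_eq eq Conf_distinct assms(1) by blast
qed

text \<open>Iterates \<open>removal\<close>. In particular \<open>down e\<close> is realised by a
  vertex, which will be min(H).\<close>

lemma downset_realized:
  assumes "ws \<in> Conf" "downset X" "X \<subseteq> events ws"
  obtains us where "us \<in> Conf" "events us = X"
  using assms
proof (induction "card (events ws)" arbitrary: ws thesis rule: less_induct)
  case less
  show ?case
  proof (cases "events ws \<subseteq> X")
    case False
    then obtain us e where us: "extends us e ws" "e \<notin> X" "us \<in> Conf" using removal less.prems by blast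
    then have "events ws = insert e (events us)" "e \<notin> events us" using extends_events extends_notin by auto
    then have "card (events us) < card (events ws)" "X \<subseteq> events us"
      using finite_events[of us] us(2) less.prems(4) by auto
    then show ?thesis using less.hyps[of us] less.prems us by blast
  qed (use less.prems in blast)
qed

section \<open>Hyperplanes and half-spaces\<close>

text \<open>Mirrors \<open>add\<close>; \<open>pr\<close> only appends a letter in practice, since
  \<open>fits\<close> admits a caret only below a string wire.\<close>

fun wadd :: "att \<Rightarrow> wire list \<Rightarrow> wire list" where
  "wadd (S i) ws = take i ws @ [pr False (ws ! i), pr True (ws ! i)] @ drop (Suc i) ws"
| "wadd (M i) ws = take i ws @ [Mrg (ws ! i) (ws ! Suc i)] @ drop (Suc (Suc i)) ws"

fun transistor :: "att \<Rightarrow> wire list \<Rightarrow> wire" where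
  "transistor (S i) ws = ws ! i"
| "transistor (M i) ws = Mrg (ws ! i) (ws ! Suc i)"

fun fits :: "att \<Rightarrow> wire list \<Rightarrow> bool" where
  "fits (S i) ws \<longleftrightarrow> i < length ws \<and> (\<exists>s. ws ! i = Str s)"
| "fits (M i) ws \<longleftrightarrow> Suc i < length ws \<and> irr (Mrg (ws ! i) (ws ! Suc i))"

lemma leafpos_map: "leafpos (map shape ws) i = length (labelsF (take i ws))"
  by (simp add: leafpos_def take_map nlvF_shape[unfolded map_map comp_def, symmetric] comp_def length_concat)

lemma take_drop_2: "Suc i < length ws \<Longrightarrow> ws = take i ws @ [ws ! i, ws ! Suc i] @ drop (Suc (Suc i)) ws"
  by (metis Cons_nth_drop_Suc Suc_lessD append_Cons append_Nil append_take_drop_id)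

lemma take_drop_1: "i < length ws \<Longrightarrow> ws = take i ws @ [ws ! i] @ drop (Suc i) ws"
  by (metis Cons_nth_drop_Suc append_Cons append_Nil append_take_drop_id)

lemma fits_extends: "fits a ws \<Longrightarrow> extends ws (transistor a ws) (wadd a ws)"
proof (cases a)
  case (S i)
  assume "fits a ws"
  then obtain s where s: "i < length ws" "ws ! i = Str s" using S by auto
  then have "ws = take i ws @ [Str s] @ drop (Suc i) ws" using take_drop_1 by metis
  then show ?thesis using extends.split[of "take i ws" s "drop (Suc i) ws"] s S by simp
next
  case (M i)
  assume "fits a ws"
  then have i: "Suc i < length ws" "irr (Mrg (ws ! i) (ws ! Suc i))" using M by auto
  from extends.merge[OF i(2)] take_drop_2[OF i(1)]
  show ?thesis using M by (metis transistor.simps(2) wadd.simps(2))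
qed

lemma extends_fits:
  assumes "extends ws e ws'"
  obtains a where "fits a ws" "transistor a ws = e" "wadd a ws = ws'"
  using assms
proof cases
  case (split xs s ys)
  then show ?thesis using that[of "S (length xs)"] by (simp add: nth_append)
next
  case (merge a b xs ys)
  then show ?thesis using that[of "M (length xs)"] by (simp add: nth_append)
qed

lemma wadd_Conf: "ws \<in> Conf \<Longrightarrow> fits a ws \<Longrightarrow> wadd a ws \<in> Conf"
  using fits_extends extends_Conf by blast

lemma add_eq:
  assumes Q: "wfpic Q"
    and a: "case a of S i \<Rightarrow> i < length (snd Q) \<and> snd Q ! i = Lf | M i \<Rightarrow> Suc i < length (snd Q)"
  shows "wfpic (add a Q) \<and> wires_of (add a Q) = wadd a (wires_of Q)"
proof -
  define ws where "ws = wires_of Q"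
  define T where "T = fst Q"
  have Q': "Q = (T, map shape ws)" by (simp add: T_def ws_def shape_wires_of)
  have lab: "labelsF ws = leafstrs T" using labels_wires_of[OF Q] by (simp add: ws_def T_def)
  show ?thesis
  proof (cases a)
    case (S i)
    then have i: "i < length ws" "shape (ws ! i) = Lf" using a Q' by auto
    then obtain s where s: "ws ! i = Str s" by (cases "ws ! i") auto
    have ws: "ws = take i ws @ [Str s] @ drop (Suc i) ws" using take_drop_1 i s by metis
    have "leafstrs T = labelsF (take i ws) @ [s] @ labelsF (drop (Suc i) ws)"
      unfolding lab[symmetric] by (subst ws) simp
    from leafstrs_splitAt[OF this]
    have "leafstrs (splitAt T (leafpos (map shape ws) i)) = labelsF (wadd a ws)"
      using S s by (simp add: leafpos_map)
    moreover have "add a Q = (splitAt T (leafpos (map shape ws) i), map shape (wadd a ws))"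
      using S s Q' by (simp add: take_map drop_map)
    ultimately show ?thesis using wires_of_shape ws_def by metis
  next
    case (M i)
    then have i: "Suc i < length ws" using a Q' by auto
    have "labelsF (wadd a ws) = labelsF ws"
      by (subst (2) take_drop_2[OF i]) (simp add: M)
    moreover have "add a Q = (T, map shape (wadd a ws))"
      using M i Q' by (simp add: take_map drop_map)
    ultimately show ?thesis using wires_of_shape ws_def lab by metis
  qed
qed

lemma shape_wires_of_nth: "i < length (snd Q) \<Longrightarrow> shape (wires_of Q ! i) = snd Q ! i"
  using nth_map[of i "wires_of Q" shape] by (simp add: shape_wires_of)

lemma fits_case: 
  assumes "fits a (wires_of Q)"
  shows "case a of S i \<Rightarrow> i < length (snd Q) \<and> snd Q ! i = Lf | M i \<Rightarrow> Suc i < length (snd Q)"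
proof (cases a)
  case (S i)
  then show ?thesis using assms shape_wires_of_nth[of i Q] by auto
qed (use assms in auto)

lemma attachable_iff:
  assumes Q: "Q \<in> Vert"
  shows "attachable a Q \<longleftrightarrow> fits a (wires_of Q)"
proof
  assume a: "attachable a Q"
  have c: "case a of S i \<Rightarrow> i < length (snd Q) \<and> snd Q ! i = Lf | M i \<Rightarrow> Suc i < length (snd Q)"
    using a by (simp add: attachable_def)
  have wf: "wfpic Q" using Q by (simp add: Vert_def)
  from add_eq[OF wf c] have irr: "\<forall>w\<in>set (wadd a (wires_of Q)). irr w"
    using a reduced_iff by (auto simp: attachable_def)
  show "fits a (wires_of Q)"
  proof (cases a)
    case (S i)
    then have "i < length (wires_of Q)" "shape (wires_of Q ! i) = Lf"
      using c shape_wires_of_nth[of i Q] by simp_all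
    then show ?thesis using S by (cases "wires_of Q ! i") auto
  qed (use c irr in auto)
next
  assume a: "fits a (wires_of Q)"
  have wf: "wfpic Q" using Q by (simp add: Vert_def)
  note c = fits_case[OF a]
  have "wadd a (wires_of Q) \<in> Conf" using a Q wires_of_Conf wadd_Conf by blast
  then show "attachable a Q" using c add_eq[OF wf c] reduced_iff
    by (auto simp: attachable_def Conf_def)
qed

lemma add_Vert:
  assumes "Q \<in> Vert" "attachable a Q"
  shows "add a Q \<in> Vert" "wires_of (add a Q) = wadd a (wires_of Q)"
proof -
  have a: "fits a (wires_of Q)" "wfpic Q" using assms attachable_iff by (auto simp: Vert_def)
  have "wadd a (wires_of Q) \<in> Conf" using a assms wires_of_Conf wadd_Conf by blast
  then show "add a Q \<in> Vert" "wires_of (add a Q) = wadd a (wires_of Q)"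
    using add_eq[OF a(2) fits_case[OF a(1)]] by (auto simp: Vert_iff Conf_def)
qed

section \<open>Edges, their labels and parallelism\<close>

definition evt :: "pic \<Rightarrow> wire set" where
  "evt v = events (wires_of v)"

definition edge :: "pic \<Rightarrow> wire \<Rightarrow> pic \<Rightarrow> bool" where
  "edge Q e P \<longleftrightarrow> Q \<in> Vert \<and> P \<in> Vert \<and> extends (wires_of Q) e (wires_of P)"

lemma edgeI: "Q \<in> Vert \<Longrightarrow> attachable a Q \<Longrightarrow> edge Q (transistor a (wires_of Q)) (add a Q)"
  using add_Vert attachable_iff fits_extends by (simp add: edge_def)

lemma edgeE:
  assumes "edge Q e P"
  obtains a where "Q \<in> Vert" "attachable a Q" "transistor a (wires_of Q) = e" "P = add a Q"
proof -
  from assms obtain a where a: "fits a (wires_of Q)" "transistor a (wires_of Q) = e" "wadd a (wires_of Q) = wires_of P"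
    using extends_fits by (metis edge_def)
  then have "attachable a Q" using assms attachable_iff by (simp add: edge_def)
  moreover from this have "P = add a Q" using a add_Vert[of Q a] Vert_eqI assms by (simp add: edge_def)
  ultimately show thesis using that assms a by (simp add: edge_def)
qed

lemma Edges_iff: "x \<in> Edges \<longleftrightarrow> (\<exists>Q e P. x = {Q, P} \<and> edge Q e P)"
proof
  assume "x \<in> Edges"
  then obtain Q a where "x = {Q, add a Q}" "Q \<in> Vert" "attachable a Q" unfolding Edges_def by blast
  then show "\<exists>Q e P. x = {Q, P} \<and> edge Q e P" using edgeI by blast
next
  assume "\<exists>Q e P. x = {Q, P} \<and> edge Q e P"
  then obtain Q e P where x: "x = {Q, P}" "edge Q e P" by blast
  obtain a where "Q \<in> Vert" "attachable a Q" "P = add a Q" by (rule edgeE[OF x(2)])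
  then show "x \<in> Edges" unfolding Edges_def x(1) mem_Collect_eq by (intro exI conjI) simp_all
qed

lemma edge_evt: "edge Q e P \<Longrightarrow> evt P = insert e (evt Q) \<and> e \<notin> evt Q"
  unfolding edge_def evt_def using extends_events extends_notin wires_of_Conf by metis

lemma Vert_evt_eqI: "v \<in> Vert \<Longrightarrow> v' \<in> Vert \<Longrightarrow> evt v = evt v' \<Longrightarrow> v = v'"
  using Conf_events_inject wires_of_Conf Vert_eqI by (simp add: evt_def)

lemma base_Vert: "base \<in> Vert" "evt base = {}"
  by (auto simp: base_def Vert_iff wfpic_def wires_of_def evt_def)

text \<open>The symmetric difference makes labels meaningful for arbitrary pairs of vertices: the relation
\<open>opp\<close> is not restricted to edges.\<close>
definition lbl :: "pic set \<Rightarrow> wire \<Rightarrow> bool" where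
  "lbl x e \<longleftrightarrow> (\<exists>u w. x = {u, w} \<and> evt u - evt w \<union> (evt w - evt u) = {e})"

lemma lbl_pair: "lbl {u, w} e \<longleftrightarrow> evt u - evt w \<union> (evt w - evt u) = {e}"
proof
  assume "lbl {u, w} e"
  then obtain u' w' where "{u, w} = {u', w'}" "evt u' - evt w' \<union> (evt w' - evt u') = {e}"
    by (auto simp: lbl_def)
  then show "evt u - evt w \<union> (evt w - evt u) = {e}" by (auto simp: doubleton_eq_iff Un_commute)
qed (unfold lbl_def, blast)

lemma lbl_unique: "lbl x e \<Longrightarrow> lbl x e' \<Longrightarrow> e = e'"
  by (metis lbl_def lbl_pair singleton_inject)

lemma edge_Edges: "edge Q e P \<Longrightarrow> {Q, P} \<in> Edges"
  unfolding Edges_iff by blast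

lemma edge_lbl: "edge Q e P \<Longrightarrow> lbl {Q, P} e"
  using edge_evt[of Q e P] by (auto simp: lbl_pair)

lemma Edges_lbl_edge:
  assumes "x \<in> Edges" "lbl x e"
  obtains Q P where "x = {Q, P}" "edge Q e P"
  using assms edge_lbl lbl_unique Edges_iff by metis

text \<open>Attaching \<open>a\<close> moves positions, but names of transistors are independent of
  positions.\<close>

lemma trans_shift:
  assumes "fits a ws" "fits b ws" "wires a \<inter> wires b = {}"
  shows "transistor (shift a b) (wadd a ws) = transistor b ws"
proof -
  have [simp]: "Suc 0 < j \<Longrightarrow> Suc (Suc (j - 2)) = j" for j by simp
  show ?thesis
    using assms by (cases a; cases b) (auto simp: nth_append nth_Cons' min_def not_less)
qed

lemma sq_events:
  assumes "sq Q a b"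
  obtains e f where "evt (add a Q) = insert e (evt Q)" "evt (add b Q) = insert f (evt Q)"
    "evt (add (shift a b) (add a Q)) = insert f (insert e (evt Q))" "e \<notin> evt Q" "f \<notin> insert e (evt Q)"
proof -
  from assms have Q: "Q \<in> Vert" and a: "attachable a Q" and b: "attachable b Q"
    and w: "wires a \<inter> wires b = {}" and c: "attachable (shift a b) (add a Q)" by (auto simp: sq_def)
  have "transistor (shift a b) (wires_of (add a Q)) = transistor b (wires_of Q)"
    using trans_shift a b w attachable_iff add_Vert Q by metis
  then show thesis using that edge_evt[OF edgeI[OF Q a]] edge_evt[OF edgeI[OF Q b]]
    edge_evt[OF edgeI[OF add_Vert(1)[OF Q a] c]] by metis
qed

lemma opp_lbl:
  assumes "opp x y" shows "lbl x e \<longleftrightarrow> lbl y e"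
proof -
  obtain Q a b where sq: "sq Q a b" and
    xy: "x = {Q, add a Q} \<and> y = {add b Q, add (shift a b) (add a Q)} \<or>
      x = {Q, add b Q} \<and> y = {add a Q, add (shift a b) (add a Q)}"
    using assms by (auto simp: opp_def Let_def)
  from sq_events[OF sq] obtain e' f where ef: "evt (add a Q) = insert e' (evt Q)" "evt (add b Q) = insert f (evt Q)"
    "evt (add (shift a b) (add a Q)) = insert f (insert e' (evt Q))" "e' \<notin> evt Q" "f \<notin> insert e' (evt Q)" .
  have "lbl {Q, add a Q} e'" "lbl {add b Q, add (shift a b) (add a Q)} e'"
    "lbl {Q, add b Q} f" "lbl {add a Q, add (shift a b) (add a Q)} f"
    unfolding lbl_pair ef using ef(4,5) by auto
  then show ?thesis using xy lbl_unique by metis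
qed

abbreviation par :: "pic set \<Rightarrow> pic set \<Rightarrow> bool" where
  "par \<equiv> (\<lambda>x y. opp x y \<or> opp y x)\<^sup>*\<^sup>*"

lemma par_lbl: "par x y \<Longrightarrow> lbl x e \<Longrightarrow> lbl y e"
  by (induction rule: rtranclp_induct) (auto simp: opp_lbl)

lemma par_sym: "par x y \<Longrightarrow> par y x"
  by (rule sympD[OF symp_rtranclp]) (auto intro: sympI)

text \<open>If \<open>a\<close> does not precede \<open>b'\<close>, then \<open>b'\<close> uses no
  wire produced by \<open>a\<close>, so it could have been attached first. The witness reverses
  \<open>shift\<close>: to the right of \<open>a\<close> the index drops by one past a caret and
  rises by one past a merge.\<close>

lemma unshift:
  assumes "fits a ws" "fits b' (wadd a ws)" "transistor a ws \<notin> down (transistor b' (wadd a ws))"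
  obtains b where "wires a \<inter> wires b = {}" "shift a b = b'" "fits b ws"
proof (cases a; cases b')
  fix i j assume ab: "a = S i" "b' = S j"
  obtain s where s: "ws ! i = Str s" "i < length ws" using assms ab by auto
  have "j \<noteq> i" "j \<noteq> Suc i" using assms s ab by (auto simp: nth_append)
  then consider "j < i" | k where "j = Suc (Suc k)" "i \<le> k"
    by (metis Suc_leI Suc_lessI le_Suc_ex nat_neq_iff add_Suc le_add1)
  then show thesis
  proof cases
    case 1
    then show thesis using that[of "S j"] assms ab s by (auto simp: nth_append)
  next
    case 2
    then show thesis using that[of "S (Suc k)"] assms ab s by (auto simp: nth_append)
  qed
next
  fix i j assume ab: "a = S i" "b' = M j"
  obtain s where s: "ws ! i = Str s" "i < length ws" using assms ab by auto
  have "j \<noteq> i" "j \<noteq> Suc i" "Suc j \<noteq> i" using assms s ab by (auto simp: nth_append strict_prefix_def)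
  then consider "Suc j < i" | k where "j = Suc (Suc k)" "i \<le> k"
    by (metis Suc_leI Suc_lessI le_Suc_ex nat_neq_iff add_Suc le_add1)
  then show thesis
  proof cases
    case 1
    then show thesis using that[of "M j"] assms ab s by (auto simp: nth_append)
  next
    case 2
    then show thesis using that[of "M (Suc k)"] assms ab s by (auto simp: nth_append)
  qed
next
  fix i j assume ab: "a = M i" "b' = S j"
  have "j \<noteq> i" using assms ab by (auto simp: nth_append)
  then consider "j < i" | k where "j = Suc k" "i \<le> k"
    by (metis Suc_leI le_Suc_ex nat_neq_iff add_Suc le_add1)
  then show thesis
  proof cases
    case 1
    then show thesis using that[of "S j"] assms ab by (auto simp: nth_append)
  next
    case 2
    then show thesis using that[of "S (Suc j)"] assms ab by (auto simp: nth_append)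
  qed
next
  fix i j assume ab: "a = M i" "b' = M j"
  have "j \<noteq> i" "Suc j \<noteq> i" using assms ab by (auto simp: nth_append)
  then consider "Suc j < i" | k where "j = Suc k" "i \<le> k"
    by (metis Suc_leI Suc_lessI le_Suc_ex nat_neq_iff add_Suc le_add1)
  then show thesis
  proof cases
    case 1
    then show thesis using that[of "M j"] assms ab by (auto simp: nth_append)
  next
    case 2
    then show thesis using that[of "M (Suc j)"] assms ab by (auto simp: nth_append)
  qed
qed

definition halfsp :: "wire \<Rightarrow> pic set" where
  "halfsp e = {v \<in> Vert. e \<in> evt v}"

definition Ev :: "wire set" where
  "Ev = (\<Union>v\<in>Vert. evt v)"

definition hyp :: "wire \<Rightarrow> pic set set" where
  "hyp e = {x \<in> Edges. lbl x e}"

lemma edge_down: "edge Q e P \<Longrightarrow> down e - {e} \<subseteq> evt Q"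
  using edge_evt[of Q e P] downset_events[of "wires_of P"] by (auto simp: downset_def evt_def)

lemma removal_edge:
  assumes "v \<in> Vert" "downset X" "\<not> evt v \<subseteq> X"
  obtains u f where "edge u f v" "f \<notin> X"
proof -
  obtain us f where us: "extends us f (wires_of v)" "f \<notin> X" "us \<in> Conf"
    using removal wires_of_Conf assms unfolding evt_def by metis
  then obtain u where "u \<in> Vert" "wires_of u = us" using Conf_obtain by metis
  then have "edge u f v" using us assms by (simp add: edge_def)
  then show thesis using that us by blast
qed

text \<open>Slides the edge across squares towards \<open>base\<close>: a maximal transistor of
  \<open>Q\<close> that does not precede \<open>e\<close> commutes with \<open>e\<close>, and the
  square they span carries the edge to a smaller vertex. The final edge depends on \<open>e\<close>
  alone, so equal labels imply parallel edges.\<close>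

lemma par_minimal:
  assumes "edge Q e P"
  shows "\<exists>u w. edge u e w \<and> par {Q, P} {u, w} \<and> evt u = down e - {e}"
  using assms
proof (induction "card (evt Q)" arbitrary: Q P rule: less_induct)
  case less
  show ?case
  proof (cases "evt Q \<subseteq> down e - {e}")
    case True
    then show ?thesis using edge_down[OF less.prems] less.prems by blast
  next
    case False
    have "Q \<in> Vert" using less.prems by (simp add: edge_def)
    then obtain u f where u: "edge u f Q" "f \<notin> down e - {e}"
      using removal_edge downset_down_less False by metis
    obtain a where a: "u \<in> Vert" "attachable a u" "transistor a (wires_of u) = f" "Q = add a u" using edgeE[OF u(1)] .
    obtain b' where b': "attachable b' Q" "transistor b' (wires_of Q) = e" "P = add b' Q" using edgeE[OF less.prems] .
    have "f \<noteq> e" using edge_evt[OF u(1)] edge_evt[OF less.prems] by auto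
    then have "f \<notin> down e" using u by blast
    then obtain b where b: "wires a \<inter> wires b = {}" "shift a b = b'" "fits b (wires_of u)"
      using unshift[of a "wires_of u" b'] a b' attachable_iff add_Vert \<open>Q \<in> Vert\<close> by metis
    then have sq: "sq u a b" using a b' by (simp add: sq_def attachable_iff)
    then have opp: "opp {u, add b u} {Q, P}" unfolding opp_def Let_def using a b b' by blast
    have "transistor b (wires_of u) = e"
      using trans_shift[of a "wires_of u" b] a b b' attachable_iff add_Vert by metis
    then have e: "edge u e (add b u)" using edgeI[of u b] a b attachable_iff by metis
    have "card (evt u) < card (evt Q)"
      using edge_evt[OF u(1)] finite_events[of "wires_of u"] by (simp add: evt_def)
    from less.hyps[OF this e] obtain u' w' where "edge u' e w'" "par {u, add b u} {u', w'}" "evt u' = down e - {e}" by blast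
    moreover have "par {Q, P} {u', w'}" using opp calculation(2) by (metis (mono_tags, lifting) converse_rtranclp_into_rtranclp)
    ultimately show ?thesis by blast
  qed
qed

lemma edge_minimal_unique:
  "edge u e w \<Longrightarrow> edge u' e w' \<Longrightarrow> evt u = evt u' \<Longrightarrow> u = u' \<and> w = w'"
  using edge_evt[of u e w] edge_evt[of u' e w'] Vert_evt_eqI unfolding edge_def by metis

lemma same_lbl_par: "edge Q e P \<Longrightarrow> edge Q' e P' \<Longrightarrow> par {Q, P} {Q', P'}"
  using par_minimal[of Q e P] par_minimal[of Q' e P'] edge_minimal_unique par_sym rtranclp_trans
  by (metis (no_types, lifting))

lemma hyp_eq:
  assumes "edge Q e P"
  shows "{f \<in> Edges. par {Q, P} f} = hyp e"
proof -
  have "par {Q, P} x \<longleftrightarrow> lbl x e" if "x \<in> Edges" for x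
  proof
    show "lbl x e" if "par {Q, P} x" by (rule par_lbl[OF that edge_lbl[OF assms]])
    assume "lbl x e"
    then obtain Q' P' where "x = {Q', P'}" "edge Q' e P'" using Edges_lbl_edge \<open>x \<in> Edges\<close> by metis
    then show "par {Q, P} x" using same_lbl_par[OF assms] by simp
  qed
  then show ?thesis unfolding hyp_def by blast
qed

lemma Ev_minimal:
  assumes "e \<in> Ev"
  obtains v where "v \<in> Vert" "evt v = down e"
proof -
  obtain v where v: "v \<in> Vert" "e \<in> evt v" using assms by (auto simp: Ev_def)
  then have "down e \<subseteq> events (wires_of v)" using downset_events[of "wires_of v"] by (auto simp: downset_def evt_def)
  then obtain us where "us \<in> Conf" "events us = down e"
    using downset_realized downset_down v wires_of_Conf by metis
  then show thesis using that Conf_obtain evt_def by metis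
qed

lemma Ev_edge:
  assumes "e \<in> Ev" obtains Q P where "edge Q e P"
proof -
  obtain v where v: "v \<in> Vert" "evt v = down e" using Ev_minimal assms .
  moreover have "\<not> evt v \<subseteq> down e - {e}" using v by auto
  ultimately obtain u f where u: "edge u f v" "f \<notin> down e - {e}" using removal_edge downset_down_less by metis
  then have "f = e" using edge_evt[OF u(1)] v by auto
  then show thesis using that u by blast
qed

lemma edge_Ev: "edge Q e P \<Longrightarrow> e \<in> Ev"
  using edge_evt[of Q e P] by (auto simp: Ev_def edge_def)

lemma Hyps_eq: "Hyps = hyp ` Ev"
proof
  show "Hyps \<subseteq> hyp ` Ev"
  proof
    fix H assume "H \<in> Hyps"
    then obtain x where x: "x \<in> Edges" "H = {f \<in> Edges. par x f}" by (auto simp: Hyps_def)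
    then obtain Q e P where "x = {Q, P}" "edge Q e P" using Edges_iff by metis
    then show "H \<in> hyp ` Ev" using x hyp_eq edge_Ev by blast
  qed
  show "hyp ` Ev \<subseteq> Hyps"
  proof
    fix H assume "H \<in> hyp ` Ev"
    then obtain e Q P where "H = hyp e" "edge Q e P" using Ev_edge by blast
    then have "{Q, P} \<in> Edges" "H = {f \<in> Edges. par {Q, P} f}" using hyp_eq edge_Edges by blast+
    then show "H \<in> Hyps" by (auto simp: Hyps_def)
  qed
qed

text \<open>Transistors are removed one by one; \<open>e\<close> is never among them, so the path
  stays off \<open>hyp e\<close>.\<close>

lemma base_path:
  assumes "v \<in> Vert" "e \<notin> evt v"
  shows "(\<lambda>u w. {u, w} \<in> Edges - hyp e)\<^sup>*\<^sup>* base v"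
  using assms
proof (induction "card (evt v)" arbitrary: v rule: less_induct)
  case less
  show ?case
  proof (cases "evt v \<subseteq> {}")
    case True
    then have "v = base" using Vert_evt_eqI base_Vert less.prems by simp
    then show ?thesis by simp
  next
    case False
    then obtain u f where u: "edge u f v"
      using removal_edge[OF less.prems(1), of "{}"] by (auto simp: downset_def)
    note ev = edge_evt[OF u]
    have "card (evt u) < card (evt v)"
      using ev finite_events[of "wires_of u"] by (simp add: evt_def)
    moreover have "u \<in> Vert" "e \<notin> evt u" using u ev less.prems by (auto simp: edge_def)
    ultimately have "(\<lambda>u w. {u, w} \<in> Edges - hyp e)\<^sup>*\<^sup>* base u" using less.hyps by blast
    moreover have "f \<noteq> e" using ev less.prems by blast
    then have "\<not> lbl {u, v} e" using lbl_unique[OF edge_lbl[OF u]] by blast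
    then have "{u, v} \<in> Edges - hyp e" using edge_Edges[OF u] by (simp add: hyp_def)
    ultimately show ?thesis by (rule rtranclp.rtrancl_into_rtrancl)
  qed
qed

text \<open>Edges off \<open>hyp e\<close> add or delete a transistor other than \<open>e\<close>,
  so membership of \<open>e\<close> is constant along paths avoiding \<open>hyp e\<close>.\<close>

lemma hplus_hyp: "hplus (hyp e) = halfsp e"
proof -
  have "e \<notin> evt v" if "(\<lambda>u w. {u, w} \<in> Edges - hyp e)\<^sup>*\<^sup>* base v" for v
    using that
  proof (induction rule: rtranclp_induct)
    case (step y z)
    then have yz: "{y, z} \<in> Edges" "\<not> lbl {y, z} e" by (auto simp: hyp_def)
    then obtain Q f P where f: "{y, z} = {Q, P}" "edge Q f P" using Edges_iff by metis
    then have "f \<noteq> e" using yz edge_lbl by metis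
    then show ?case using edge_evt[OF f(2)] step.IH f(1) by (auto simp: doubleton_eq_iff)
  qed (simp add: base_Vert)
  then show ?thesis unfolding hplus_def halfsp_def using base_path by blast
qed

lemma PHS_eq: "PHS = halfsp ` Ev"
  by (auto simp: PHS_def Hyps_eq hplus_hyp image_image)

text \<open>The vertex with events \<open>down f\<close> is the least one in
  \<open>halfsp f\<close>, so it alone decides the inclusion.\<close>

lemma hle_halfsp:
  assumes "f \<in> Ev" shows "hle (halfsp e) (halfsp f) \<longleftrightarrow> e \<in> down f"
proof
  assume "hle (halfsp e) (halfsp f)"
  moreover obtain v where "v \<in> Vert" "evt v = down f" using Ev_minimal assms .
  ultimately show "e \<in> down f" by (auto simp: hle_def halfsp_def)
next
  assume "e \<in> down f"
  then show "hle (halfsp e) (halfsp f)"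
    using downset_events unfolding hle_def halfsp_def evt_def downset_def by blast
qed

lemma halfsp_inject: "e \<in> Ev \<Longrightarrow> f \<in> Ev \<Longrightarrow> halfsp e = halfsp f \<longleftrightarrow> e = f"
  using hle_halfsp down_antisym by (metis hle_def subset_refl)

section \<open>Minimal vertices of carets and the sets \<open>PS\<close>\<close>

lemma pathtree_neq_Lf [simp]: "pathtree s \<noteq> Lf" "Lf \<noteq> pathtree s"
  by (cases s rule: pathtree.cases; simp)+

lemma pathtree_inject: "pathtree s = pathtree s' \<longleftrightarrow> s = s'"
proof (induction s arbitrary: s' rule: pathtree.induct)
  case 1
  then show ?case by (cases s' rule: pathtree.cases) auto
next
  case (2 s)
  then show ?case by (cases s' rule: pathtree.cases) auto
next
  case (3 s)
  then show ?case by (cases s' rule: pathtree.cases) auto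
qed

lemma prune_empty: "prune t {} = Lf"
  by (cases t) auto

lemma prune_path:
  "l \<in> set (leafstrs t) \<Longrightarrow> strict_prefix s l \<Longrightarrow> prune t {p. prefix p s} = pathtree s"
proof (induction s arbitrary: t l rule: pathtree.induct)
  case 1
  then obtain a b where "t = Nd a b" by (cases t) auto
  then show ?case by (simp add: prune_empty)
next
  case (2 s)
  then obtain a b where t: "t = Nd a b" by (cases t) auto
  with 2 obtain l' where "l = False # l'" "l' \<in> set (leafstrs a)" by auto
  then show ?case using 2 t by (simp add: prune_empty)
next
  case (3 s)
  then obtain a b where t: "t = Nd a b" by (cases t) auto
  with 3 obtain l' where "l = True # l'" "l' \<in> set (leafstrs b)" by auto
  then show ?case using 3 t by (simp add: prune_empty)
qed

text \<open>A caret is pruned to the path leading to it, which determines its address. A merge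
  leaves a non-leaf in the forest, so its minimal vertex is never a tree of carets.\<close>

lemma minE_pathtree:
  assumes Q: "Q \<in> Vert" "attachable a Q"
  shows "minE Q a = (pathtree s, replicate (nlv (pathtree s)) Lf) \<longleftrightarrow> transistor a (wires_of Q) = Str s"
proof -
  define ws where "ws = wires_of Q"
  have lab: "labelsF ws = leafstrs (fst Q)" using labels_wires_of Q by (simp add: ws_def Vert_def)
  have sh: "snd Q = map shape ws" by (simp add: ws_def shape_wires_of)
  have fits: "fits a ws" using Q attachable_iff ws_def by blast
  show ?thesis
  proof (cases a)
    case (S i)
    then obtain t where t: "i < length ws" "ws ! i = Str t" using fits by auto
    have "leafstrs (fst Q) = labelsF (take i ws) @ [t] @ labelsF (drop (Suc i) ws)"
      unfolding lab[symmetric] by (subst take_drop_1[OF t(1)]) (simp add: t(2))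
    then have l: "leafstrs (fst Q) ! leafpos (snd Q) i = t" by (simp add: sh leafpos_map)
    have "labelsF (wires_of (add a Q)) = leafstrs (fst (add a Q))" 
      using labels_wires_of[of "add a Q"] add_Vert(1)[OF Q] Vert_iff by blast
    moreover have "t @ [False] \<in> set (labelsF (wadd a ws))" using S t by simp
    ultimately have "t @ [False] \<in> set (leafstrs (fst (add a Q)))"
      using add_Vert(2)[OF Q] unfolding ws_def by simp
    then have "prune (fst (add a Q)) {p. prefix p t} = pathtree t"
      by (rule prune_path) (simp add: strict_prefix_def)
    then have "minE Q a = (pathtree t, replicate (nlv (pathtree t)) Lf)"
      using S l by (simp add: minE_def Let_def)
    then show ?thesis using pathtree_inject S t by (auto simp: ws_def)
  next
    case (M i)
    have i: "Suc i < length ws" using fits M by simp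
    have "snd (add a Q) = map shape (wadd a ws)"
      using add_Vert[OF Q] shape_wires_of[of "add a Q"] by (simp add: ws_def)
    then have "snd (add a Q) ! i = Nd (shape (ws ! i)) (shape (ws ! Suc i))"
      using i M by (simp add: nth_append)
    then have "Nd (shape (ws ! i)) (shape (ws ! Suc i)) \<in> set (snd (minE Q a))"
      using M by (simp add: minE_def Let_def)
    then have "minE Q a \<noteq> (pathtree s, replicate (nlv (pathtree s)) Lf)"
      by (metis in_set_replicate snd_conv tr.distinct(1))
    then show ?thesis using M by simp
  qed
qed

lemma leafstrs_pathtree: "s @ [c] \<in> set (leafstrs (pathtree s))"
  by (induction s rule: pathtree.induct) (cases c; auto)+

lemma tree_Vert: "(t, replicate (nlv t) Lf) \<in> Vert" "wires_of (t, replicate (nlv t) Lf) = map Str (leafstrs t)"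
proof -
  have *: "labF (replicate (length ss) Lf) ss = map Str ss" for ss by (induction ss) auto
  show w: "wires_of (t, replicate (nlv t) Lf) = map Str (leafstrs t)"
    using *[of "leafstrs t"] by (simp add: wires_of_def)
  show "(t, replicate (nlv t) Lf) \<in> Vert" by (auto simp: Vert_iff w wfpic_def sum_list_replicate)
qed

lemma evt_tree: "evt (t, replicate (nlv t) Lf) = {Str s | s. \<exists>l\<in>set (leafstrs t). strict_prefix s l}"
  by (auto simp: evt_def tree_Vert events_def)

lemma Str_Ev: "Str s \<in> Ev"
  unfolding Ev_def
proof (rule UN_I[OF tree_Vert(1)])
  show "Str s \<in> evt (pathtree s, replicate (nlv (pathtree s)) Lf)"
    unfolding evt_tree using leafstrs_pathtree[of s True] prefix_snoc
    by (auto simp: strict_prefix_def intro!: bexI[of _ "s @ [True]"])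
qed

text \<open>All edges of a hyperplane carry one label, so whichever edge witnesses the condition in
  \<open>PS\<close> names the same transistor.\<close>

lemma PS_eq: "PS X = halfsp ` Str ` X"
proof -
  define R where "R H \<longleftrightarrow> (\<exists>Q a s. Q \<in> Vert \<and> attachable a Q \<and> {Q, add a Q} \<in> H \<and> s \<in> X
         \<and> minE Q a = (pathtree s, replicate (nlv (pathtree s)) Lf))" for H
  have *: "R (hyp e) \<longleftrightarrow> e \<in> Str ` X"
    if e: "e \<in> Ev" for e
  proof
    assume "R (hyp e)"
    then obtain Q a s where Q: "Q \<in> Vert" "attachable a Q" "{Q, add a Q} \<in> hyp e" "s \<in> X"
      "minE Q a = (pathtree s, replicate (nlv (pathtree s)) Lf)" unfolding R_def by blast
    then have "transistor a (wires_of Q) = Str s" using minE_pathtree by blast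
    then have "lbl {Q, add a Q} (Str s)" using edge_lbl[OF edgeI[OF Q(1,2)]] by simp
    moreover have "lbl {Q, add a Q} e" using Q(3) by (simp add: hyp_def)
    ultimately show "e \<in> Str ` X" using Q(4) lbl_unique by blast
  next
    assume "e \<in> Str ` X"
    then obtain s where s: "e = Str s" "s \<in> X" by blast
    obtain Q P where QP: "edge Q e P" using Ev_edge e .
    then obtain a where a: "Q \<in> Vert" "attachable a Q" "transistor a (wires_of Q) = e" "P = add a Q" by (rule edgeE)
    then have "{Q, add a Q} \<in> hyp e" using edge_lbl[OF QP] edge_Edges[OF QP] by (simp add: hyp_def)
    moreover have "minE Q a = (pathtree s, replicate (nlv (pathtree s)) Lf)"
      using minE_pathtree[OF a(1,2)] a(3) s by blast
    ultimately show "R (hyp e)" unfolding R_def using a s by blast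
  qed
  have "PS X = {hplus H | H. H \<in> Hyps \<and> R H}" unfolding PS_def R_def ..
  also have "\<dots> = {hplus (hyp e) | e. e \<in> Ev \<and> R (hyp e)}" unfolding Hyps_eq by blast
  also have "\<dots> = halfsp ` {e \<in> Ev. R (hyp e)}" unfolding hplus_hyp by blast
  also have "{e \<in> Ev. R (hyp e)} = Str ` X" using * Str_Ev by blast
  finally show ?thesis .
qed

section \<open>The action of F on profiles\<close>

fun is_caret :: "wire \<Rightarrow> bool" where
  "is_caret (Str s) \<longleftrightarrow> True"
| "is_caret (Mrg a b) \<longleftrightarrow> False"

abbreviation move :: "pic \<Rightarrow> wire \<Rightarrow> wire" where
  "move g \<equiv> subst (root_image g)"

text \<open>Irregular transistors are those whose hyperplane may be flipped by \<open>g\<close>, so that the image of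
the positive half-space need not be positive.  They have bounded size.\<close>
definition regular :: "pic \<Rightarrow> wire \<Rightarrow> bool" where
  "regular g e \<longleftrightarrow> is_caret (move g e) = is_caret e"

lemma is_caretD: "is_caret e \<Longrightarrow> \<exists>s. e = Str s"
  by (cases e) auto

lemma irr_evs_Mrg: "Mrg a b \<in> evs w \<Longrightarrow> irr w \<Longrightarrow> irr (Mrg a b)"
  by (induction w) (auto simp del: irr.simps(2), auto)

lemma irr_Ev: "e \<in> Ev \<Longrightarrow> irr e"
proof (cases e)
  case (Mrg a b)
  assume "e \<in> Ev"
  then obtain v w where "v \<in> Vert" "w \<in> set (wires_of v)" "e \<in> evs w" by (auto simp: Ev_def evt_def events_def)
  then show ?thesis using irr_evs_Mrg Mrg Vert_iff by metis
qed simp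

lemma Ev_down: "e \<in> Ev \<Longrightarrow> down e \<subseteq> Ev"
  using Ev_minimal by (metis Ev_def UN_upper)

lemma move_inverse_pic:
  assumes "g \<in> ThompsonF" "irr e"
  shows "move g (move (inverse_pic g) e) = e" "move (inverse_pic g) (move g e) = e"
  using subst_inverse_pic assms by auto

lemma move_inject: "g \<in> ThompsonF \<Longrightarrow> irr e \<Longrightarrow> irr f \<Longrightarrow> move g e = move g f \<longleftrightarrow> e = f"
  by (metis move_inverse_pic(2))

lemma regular_inverse_pic: "g \<in> ThompsonF \<Longrightarrow> irr e \<Longrightarrow> regular g e \<Longrightarrow> regular (inverse_pic g) (move g e)"
  by (simp add: regular_def move_inverse_pic)

lemma evs_mk: "Mrg c d \<in> evs a \<union> evs b \<Longrightarrow> Mrg c d \<in> evs (mk a b)"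
  by (cases a b rule: mk_cases) auto

text \<open>Merges survive because \<open>mk\<close> collapses only pairs of strings. For carets, a
  collapse to \<open>Str u\<close> destroys only the caret at \<open>u\<close> itself.\<close>

lemma move_evs:
  assumes g: "g \<in> ThompsonF" and "regular g e" "irr x" "e \<in> evs x"
  shows "move g e \<in> evs (move g x)"
proof (cases e)
  case e: (Mrg a b)
  then obtain c d where cd: "move g e = Mrg c d" using assms(2) by (cases "move g e") (auto simp: regular_def)
  show ?thesis using assms(3,4)
  proof (induction x)
    case (Mrg y z)
    show ?case
    proof (cases "e = Mrg y z")
      case True
      then show ?thesis using cd by simp
    next
      case False
      then have "move g e \<in> evs (move g y) \<union> evs (move g z)" using Mrg by auto
      then show ?thesis using evs_mk cd by simp
    qed
  qed (use e in auto)
next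
  case e: (Str s)
  then obtain s' where s': "move g e = Str s'" using assms(2) is_caretD by (auto simp: regular_def)
  show ?thesis using assms(3,4)
  proof (induction x)
    case (Str l)
    then obtain z where "l = s @ z" "z \<noteq> []" using e by (auto elim: strict_prefixE')
    then show ?case using s' e by (auto simp: desc_append strict_prefix_def)
  next
    case (Mrg y z)
    then have *: "Str s' \<in> evs (move g y) \<union> evs (move g z)" using e s' by auto
    show ?case
    proof (cases "move g y" "move g z" rule: mk_cases)
      case (1 u)
      then have "prefix s' u" using * by (auto simp: strict_prefix_def)
      \<comment> \<open>Were the lost caret the image of \<open>s\<close>, injectivity would make
        \<open>y\<close> and \<open>z\<close> the two children of \<open>s\<close>, a dipole in an
        irreducible wire.\<close>
      moreover have "s' \<noteq> u"
      proof
        assume "s' = u"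
        then have "move g (Str (s @ [c])) = Str (u @ [c])" for c using s' e by (simp add: desc_append)
        then have "y = Str (s @ [False])" "z = Str (s @ [True])"
          using 1 move_inject[OF g] Mrg.prems(1) by (metis irr.simps)+
        then show False using Mrg.prems(1) by auto
      qed
      ultimately show ?thesis using 1 s' by (auto simp: strict_prefix_def)
    next
      case 2
      then show ?thesis using * s' by auto
    qed
  qed
qed

lemma move_evt:
  assumes "g \<in> ThompsonF" "regular g e" "v \<in> Vert" "e \<in> evt v"
  shows "move g e \<in> evt (act g v)"
proof -
  obtain w where "w \<in> set (wires_of v)" "e \<in> evs w" using assms(4) by (auto simp: evt_def events_def)
  moreover from this have "irr w" using assms(3) Vert_iff by blast
  ultimately show ?thesis
    using move_evs[OF assms(1,2)] assms by (auto simp: evt_def act_wires events_def)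
qed

lemma move_Ev:
  assumes "g \<in> ThompsonF" "regular g e" "e \<in> Ev" shows "move g e \<in> Ev"
proof -
  obtain v where v: "v \<in> Vert" "e \<in> evt v" using assms(3) unfolding Ev_def by blast
  show ?thesis using move_evt[OF assms(1,2) v] act_wires(1)[OF assms(1) v(1)] unfolding Ev_def by blast
qed

lemma gH_halfsp:
  assumes g: "g \<in> ThompsonF" and e: "e \<in> Ev" "regular g e"
  shows "gH g (halfsp e) = halfsp (move g e)"
proof
  show "gH g (halfsp e) \<subseteq> halfsp (move g e)"
    using move_evt[OF g e(2)] act_wires(1)[OF g] unfolding gH_def halfsp_def by blast
  show "halfsp (move g e) \<subseteq> gH g (halfsp e)"
  proof
    fix v assume v: "v \<in> halfsp (move g e)"
    have sg: "inverse_pic g \<in> ThompsonF" using g by (rule inverse_pic_ThompsonF)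
    have "move (inverse_pic g) (move g e) \<in> evt (act (inverse_pic g) v)"
      using move_evt[OF sg regular_inverse_pic[OF g irr_Ev[OF e(1)] e(2)]] v by (simp add: halfsp_def)
    then have "act (inverse_pic g) v \<in> halfsp e"
      using v act_wires(1)[OF sg] move_inverse_pic(2)[OF g irr_Ev[OF e(1)]] by (simp add: halfsp_def)
    moreover have "act g (act (inverse_pic g) v) = v" using act_inverse_pic(1)[OF g] v by (simp add: halfsp_def)
    ultimately show "v \<in> gH g (halfsp e)" unfolding gH_def by (metis imageI)
  qed
qed

lemma move_down:
  assumes g: "g \<in> ThompsonF" and e: "e \<in> Ev" "regular g e" and f: "f \<in> Ev" "regular g f" and "e \<in> down f"
  shows "move g e \<in> down (move g f)"
proof -
  have "halfsp f \<subseteq> halfsp e" using assms hle_halfsp by (simp add: hle_def)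
  then have "gH g (halfsp f) \<subseteq> gH g (halfsp e)" unfolding gH_def by blast
  then have "hle (halfsp (move g e)) (halfsp (move g f))" using gH_halfsp g e f by (simp add: hle_def)
  then show ?thesis using hle_halfsp[OF move_Ev[OF g f(2,1)]] by simp
qed

lemma desc_Mrg_bound: "desc s w = Mrg a b \<Longrightarrow> length s \<le> msize w \<and> msize (Mrg a b) \<le> msize w"
proof (induction s arbitrary: w)
  case (Cons c s)
  then obtain x y where w: "w = Mrg x y" by (cases w) auto
  then show ?case using Cons.IH[of "pr c w"] Cons.prems by (cases c) auto
qed simp

text \<open>A caret \<open>s\<close> becomes a merge only if the path \<open>s\<close> ends inside
  the merges of \<open>root_image g\<close>, which bounds its length; a merge that becomes a string
  is a subwire of the root image of the inverse. The sum of the two sizes serves as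
  \<open>n\<close>.\<close>

lemma regular_large:
  assumes g: "g \<in> ThompsonF"
  obtains n where "\<And>e. irr e \<Longrightarrow> n < msize e \<Longrightarrow> regular g e"
proof (rule that)
  fix e assume e: "irr e" "msize (root_image g) + msize (root_image (inverse_pic g)) < msize e"
  show "regular g e"
  proof (cases e)
    case (Str s)
    then show ?thesis using e desc_Mrg_bound[of s "root_image g"]
      by (cases "desc s (root_image g)") (auto simp: regular_def)
  next
    case (Mrg a b)
    show ?thesis
    proof (cases "move g e")
      case (Str s)
      then have "desc s (root_image (inverse_pic g)) = Mrg a b" using move_inverse_pic(2)[OF g e(1)] Mrg by simp
      then show ?thesis using desc_Mrg_bound[of s "root_image (inverse_pic g)" a b] e Mrg by simp
    qed (use Mrg in \<open>simp add: regular_def\<close>)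
  qed
qed

section \<open>Profiles as sets of transistors\<close>

definition eprofile :: "wire set \<Rightarrow> bool" where
  "eprofile E \<longleftrightarrow> E \<noteq> {} \<and> E \<subseteq> Ev \<and> (\<forall>F. F \<subseteq> E \<and> finite F \<longrightarrow> (\<exists>v\<in>Vert. F \<subseteq> evt v))
     \<and> (\<forall>e\<in>E. \<exists>f\<in>E. e \<in> down f \<and> e \<noteq> f) \<and> (\<forall>e\<in>E. down e \<subseteq> E)"

lemma eprofileD:
  assumes "eprofile E"
  shows "E \<noteq> {}" "E \<subseteq> Ev" "F \<subseteq> E \<Longrightarrow> finite F \<Longrightarrow> \<exists>v\<in>Vert. F \<subseteq> evt v"
    "e \<in> E \<Longrightarrow> \<exists>f\<in>E. e \<in> down f \<and> e \<noteq> f" "e \<in> E \<Longrightarrow> down e \<subseteq> E"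
  using assms by (simp_all add: eprofile_def)

lemma inj_halfsp: "inj_on halfsp Ev"
  by (auto simp: inj_on_def halfsp_inject)

lemma profile_iff:
  assumes "E \<subseteq> Ev" shows "profile (halfsp ` E) \<longleftrightarrow> eprofile E"
proof -
  have 1: "halfsp ` E \<noteq> {} \<longleftrightarrow> E \<noteq> {}" by simp
  have 2: "halfsp ` E \<subseteq> PHS" using assms by (auto simp: PHS_eq)
  have 3: "(\<forall>\<F>. \<F> \<subseteq> halfsp ` E \<and> finite \<F> \<longrightarrow> \<Inter>\<F> \<noteq> {}) \<longleftrightarrow>
      (\<forall>F. F \<subseteq> E \<and> finite F \<longrightarrow> (\<exists>v\<in>Vert. F \<subseteq> evt v))"
  proof (intro iffI allI impI; elim conjE)
    fix F assume *: "\<forall>\<F>. \<F> \<subseteq> halfsp ` E \<and> finite \<F> \<longrightarrow> \<Inter>\<F> \<noteq> {}" and F: "F \<subseteq> E" "finite F"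
    show "\<exists>v\<in>Vert. F \<subseteq> evt v"
    \<comment> \<open>The intersection of the empty family is the whole type and provides no vertex,
      so \<open>base\<close> is used.\<close>
    proof (cases "F = {}")
      case False
      have "\<Inter>(halfsp ` F) \<noteq> {}" using * F by (meson finite_imageI image_mono)
      then obtain v where "v \<in> \<Inter>(halfsp ` F)" by blast
      then show ?thesis using False unfolding halfsp_def by blast
    qed (use base_Vert in blast)
  next
    fix \<F> assume *: "\<forall>F. F \<subseteq> E \<and> finite F \<longrightarrow> (\<exists>v\<in>Vert. F \<subseteq> evt v)" and "\<F> \<subseteq> halfsp ` E" "finite \<F>"
    then obtain F where F: "F \<subseteq> E" "finite F" "\<F> = halfsp ` F" by (meson finite_subset_image)
    then obtain v where "v \<in> Vert" "F \<subseteq> evt v" using * by meson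
    then have "v \<in> \<Inter>\<F>" unfolding F(3) halfsp_def by blast
    then show "\<Inter>\<F> \<noteq> {}" by blast
  qed
  have 4: "(\<forall>h\<in>halfsp ` E. \<exists>h'\<in>halfsp ` E. hle h h' \<and> h \<noteq> h') \<longleftrightarrow> (\<forall>e\<in>E. \<exists>f\<in>E. e \<in> down f \<and> e \<noteq> f)"
    using assms hle_halfsp halfsp_inject by (simp add: subset_iff)
  have 5: "(\<forall>h\<in>PHS. \<forall>h'\<in>halfsp ` E. hle h h' \<longrightarrow> h \<in> halfsp ` E) \<longleftrightarrow> (\<forall>e\<in>E. down e \<subseteq> E)"
  proof -
    have "(\<forall>h\<in>PHS. \<forall>h'\<in>halfsp ` E. hle h h' \<longrightarrow> h \<in> halfsp ` E) \<longleftrightarrow>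
       (\<forall>f\<in>Ev. \<forall>e\<in>E. hle (halfsp f) (halfsp e) \<longrightarrow> halfsp f \<in> halfsp ` E)" unfolding PHS_eq by simp
    also have "\<dots> \<longleftrightarrow> (\<forall>f\<in>Ev. \<forall>e\<in>E. f \<in> down e \<longrightarrow> f \<in> E)"
      using assms inj_on_image_mem_iff[OF inj_halfsp] hle_halfsp by (intro ball_cong refl) auto
    also have "\<dots> \<longleftrightarrow> (\<forall>e\<in>E. down e \<subseteq> E)" using assms Ev_down by blast
    finally show ?thesis .
  qed
  show ?thesis unfolding profile_def eprofile_def 1 3 4 5 using assms 2 by blast
qed

lemma profile_obtain:
  assumes "profile \<H>" obtains E where "eprofile E" "\<H> = halfsp ` E"
proof -
  have "\<H> \<subseteq> halfsp ` Ev" using assms by (simp add: profile_def PHS_eq)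
  then obtain E where "E \<subseteq> Ev" "\<H> = halfsp ` E" by (meson subset_imageE)
  then show thesis using that profile_iff assms by blast
qed

lemma eprofile_unbounded:
  assumes "eprofile E" "e \<in> E" shows "\<exists>f\<in>E. e \<in> down f \<and> n \<le> msize f"
proof (induction n)
  case (Suc n)
  then obtain f where f: "f \<in> E" "e \<in> down f" "n \<le> msize f" by blast
  then obtain f' where "f' \<in> E" "f \<in> down f'" "f \<noteq> f'" using eprofileD(4)[OF assms(1)] by blast
  moreover from this have "msize f < msize f'" using msize_down by simp
  moreover have "e \<in> down f'" using f calculation down_trans by blast
  ultimately show ?case using f by (intro bexI[of _ f']) auto
qed (use assms self_in_down in blast)

lemma eprofile_regular:
  assumes "eprofile E" "e \<in> E" "g \<in> ThompsonF"
  shows "\<exists>f\<in>E. e \<in> down f \<and> regular g f \<and> n \<le> msize f"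
proof -
  obtain m where m: "\<And>e. irr e \<Longrightarrow> m < msize e \<Longrightarrow> regular g e" using regular_large assms(3) by metis
  obtain f where f: "f \<in> E" "e \<in> down f" "Suc (m + n) \<le> msize f"
    using eprofile_unbounded[OF assms(1,2)] by blast
  then have "irr f" using irr_Ev eprofileD(2)[OF assms(1)] by blast
  then show ?thesis using f m by (intro bexI[of _ f]) auto
qed

definition push :: "pic \<Rightarrow> wire set \<Rightarrow> wire set" where
  "push g E = {f. \<exists>e\<in>E. regular g e \<and> f \<in> down (move g e)}"

text \<open>Finite subsets are compatible because \<open>g\<close> carries a vertex containing
  chosen sources to one containing their images; the other conditions use that regular transistors
  are cofinal in \<open>E\<close>.\<close>

lemma eprofile_push:
  assumes E: "eprofile E" and g: "g \<in> ThompsonF"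
  shows "eprofile (push g E)"
  unfolding eprofile_def
proof (intro conjI allI impI ballI)
  have EEv: "E \<subseteq> Ev" using E by (simp add: eprofile_def)
  obtain e0 where "e0 \<in> E" using E by (auto simp: eprofile_def)
  then obtain e where "e \<in> E" "regular g e" using eprofile_regular[OF E _ g] by blast
  then show "push g E \<noteq> {}" unfolding push_def using self_in_down by blast
  show "push g E \<subseteq> Ev" unfolding push_def using move_Ev[OF g] Ev_down EEv by blast
  show "down f \<subseteq> push g E" if "f \<in> push g E" for f
    using that down_trans unfolding push_def by blast
  show "\<exists>f'\<in>push g E. f \<in> down f' \<and> f \<noteq> f'" if "f \<in> push g E" for f
  proof -
    obtain e where e: "e \<in> E" "regular g e" "f \<in> down (move g e)" using \<open>f \<in> push g E\<close> unfolding push_def by blast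
    \<comment> \<open>The size bound makes \<open>e'\<close> differ from \<open>e\<close>, so their
      images differ as well.\<close>
    obtain e' where e': "e' \<in> E" "e \<in> down e'" "regular g e'" "Suc (msize e) \<le> msize e'"
      using eprofile_regular[OF E e(1) g] by blast
    have 1: "move g e \<in> down (move g e')" using move_down[OF g] e e' EEv by blast
    have "e \<noteq> e'" using e'(4) by auto
    then have 2: "move g e \<noteq> move g e'" using move_inject[OF g] irr_Ev e e' EEv by blast
    have "move g e' \<in> push g E" unfolding push_def using e' self_in_down by blast
    moreover have "f \<in> down (move g e')" using e(3) 1 down_trans by blast
    moreover have "f \<noteq> move g e'" using e(3) 1 2 down_antisym by blast
    ultimately show ?thesis by blast
  qed
  show "\<exists>v\<in>Vert. F \<subseteq> evt v" if F: "F \<subseteq> push g E \<and> finite F" for F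
  proof -
    have "\<forall>f\<in>F. \<exists>e. e \<in> E \<and> regular g e \<and> f \<in> down (move g e)" using F unfolding push_def by blast
    then obtain h where h: "\<forall>f\<in>F. h f \<in> E \<and> regular g (h f) \<and> f \<in> down (move g (h f))" by metis
    then have "h ` F \<subseteq> E" "finite (h ` F)" using F by auto
    then obtain v where v: "v \<in> Vert" "h ` F \<subseteq> evt v" using eprofileD(3)[OF E] by meson
    have "f \<in> evt (act g v)" if "f \<in> F" for f
    proof -
      have "move g (h f) \<in> evt (act g v)" using move_evt[OF g] h v that by blast
      then show ?thesis using h that downset_events[of "wires_of (act g v)"] unfolding downset_def evt_def by blast
    qed
    then show ?thesis using act_wires(1)[OF g v(1)] by blast
  qed
qed

text \<open>Two admissible choices dominate each other because \<open>gH g\<close> preserves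
  inclusion; downward closure of profiles then gives equality, so the \<open>THE\<close> in
  \<open>pact\<close> is well defined.\<close>

lemma pact_eqI:
  assumes K: "profile \<K>" and H': "\<H>' \<subseteq> \<H>" "cofinal \<H>' \<H>" "\<forall>h\<in>\<H>'. gH g h \<in> PHS"
    "gH g ` \<H>' \<subseteq> \<K>" "cofinal (gH g ` \<H>') \<K>"
  shows "pact g \<H> = \<K>"
  unfolding pact_def
proof (rule the_equality)
  show "profile \<K> \<and> (\<exists>\<H>'. \<H>' \<subseteq> \<H> \<and> cofinal \<H>' \<H> \<and> (\<forall>h\<in>\<H>'. gH g h \<in> PHS)
      \<and> gH g ` \<H>' \<subseteq> \<K> \<and> cofinal (gH g ` \<H>') \<K>)"
    using assms by blast
next
  have sub: "K1 \<subseteq> K2"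
    if K: "profile K1" "profile K2"
      and H1: "H1 \<subseteq> \<H>" "cofinal H1 \<H>" "\<forall>h\<in>H1. gH g h \<in> PHS" "gH g ` H1 \<subseteq> K1" "cofinal (gH g ` H1) K1"
      and H2: "H2 \<subseteq> \<H>" "cofinal H2 \<H>" "\<forall>h\<in>H2. gH g h \<in> PHS" "gH g ` H2 \<subseteq> K2" "cofinal (gH g ` H2) K2"
    for K1 K2 H1 H2
  proof
    fix k assume k: "k \<in> K1"
    then obtain h where h: "h \<in> H1" "hle k (gH g h)" using H1(5) unfolding cofinal_def by blast
    then obtain h' where h': "h' \<in> H2" "hle h h'" using H1(1) H2(2) unfolding cofinal_def by blast
    have "hle k (gH g h')" using h h' unfolding hle_def gH_def by blast
    moreover have "gH g h' \<in> K2" using h' H2(4) by blast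
    moreover have "k \<in> PHS" using K(1) k unfolding profile_def by blast
    ultimately show "k \<in> K2" using K(2) unfolding profile_def by blast
  qed
  fix \<K>2 assume *: "profile \<K>2 \<and> (\<exists>\<H>'. \<H>' \<subseteq> \<H> \<and> cofinal \<H>' \<H> \<and> (\<forall>h\<in>\<H>'. gH g h \<in> PHS)
      \<and> gH g ` \<H>' \<subseteq> \<K>2 \<and> cofinal (gH g ` \<H>') \<K>2)"
  then obtain H2 where H2: "H2 \<subseteq> \<H>" "cofinal H2 \<H>" "\<forall>h\<in>H2. gH g h \<in> PHS" "gH g ` H2 \<subseteq> \<K>2"
    "cofinal (gH g ` H2) \<K>2" by blast
  have "profile \<K>2" using * by blast
  show "\<K>2 = \<K>"
    using sub[OF \<open>profile \<K>2\<close> K H2 H'] sub[OF K \<open>profile \<K>2\<close> H' H2] by blast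
qed

lemma pact_halfsp:
  assumes E: "eprofile E" and g: "g \<in> ThompsonF"
  shows "pact g (halfsp ` E) = halfsp ` push g E"
proof (rule pact_eqI)
  let ?E' = "{e \<in> E. regular g e}"
  have EEv: "E \<subseteq> Ev" using E by (simp add: eprofile_def)
  have P: "eprofile (push g E)" using eprofile_push[OF E g] .
  then show "profile (halfsp ` push g E)" using profile_iff[OF eprofileD(2)[OF P]] by simp
  show "halfsp ` ?E' \<subseteq> halfsp ` E" by blast
  have gH: "gH g (halfsp e) = halfsp (move g e)" if "e \<in> ?E'" for e
    using gH_halfsp[OF g] that EEv by blast
  show "cofinal (halfsp ` ?E') (halfsp ` E)"
    unfolding cofinal_def
  proof clarify
    fix e assume "e \<in> E"
    then obtain f where "f \<in> E" "e \<in> down f" "regular g f" using eprofile_regular[OF E _ g] by blast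
    then show "\<exists>h'\<in>halfsp ` ?E'. hle (halfsp e) h'" using hle_halfsp EEv by blast
  qed
  show "\<forall>h\<in>halfsp ` ?E'. gH g h \<in> PHS"
  proof clarify
    fix e assume e: "e \<in> E" "regular g e"
    then have "move g e \<in> Ev" using move_Ev[OF g] EEv by blast
    then show "gH g (halfsp e) \<in> PHS" unfolding PHS_eq using gH e by simp
  qed
  show "gH g ` halfsp ` ?E' \<subseteq> halfsp ` push g E"
  proof clarify
    fix e assume e: "e \<in> E" "regular g e"
    then have "move g e \<in> push g E" unfolding push_def using self_in_down by blast
    then show "gH g (halfsp e) \<in> halfsp ` push g E" using gH e by simp
  qed
  show "cofinal (gH g ` halfsp ` ?E') (halfsp ` push g E)"
    unfolding cofinal_def
  proof clarify
    fix f assume "f \<in> push g E"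
    then obtain e where e: "e \<in> E" "regular g e" "f \<in> down (move g e)" unfolding push_def by blast
    then have "move g e \<in> Ev" using move_Ev[OF g] EEv by blast
    then have "hle (halfsp f) (gH g (halfsp e))" using gH hle_halfsp e by simp
    then show "\<exists>h'\<in>gH g ` halfsp ` ?E'. hle (halfsp f) h'" using e by blast
  qed
qed

lemma pact_fixed_iff:
  assumes "eprofile E" "g \<in> ThompsonF"
  shows "pact g (halfsp ` E) = halfsp ` E \<longleftrightarrow> push g E = E"
  using pact_halfsp[OF assms] inj_on_image_eq_iff[OF inj_halfsp]
    eprofileD(2)[OF eprofile_push[OF assms]] eprofileD(2)[OF assms(1)] by simp

section \<open>Classification of the fixed profiles\<close>

lemma pr_nf: "pr c (nf w) = nf (pr c w)"
  by (cases w) auto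

lemma desc_nf: "desc s (nf w) = nf (desc s w)"
  by (induction s arbitrary: w) (auto simp: pr_nf)

section \<open>Elements of \<open>F\<close> from pairs of trees\<close>

lemma ThompsonF_of_trees:
  assumes "nlv A = nlv B"
  obtains g where "g \<in> ThompsonF" "root_image g = nf (lab B (leafstrs A))"
proof -
  have wf: "wfpic (A, [B])" using assms by (simp add: wfpic_def)
  define g where "g = red (A, [B])"
  have w: "g \<in> Vert" "wires_of g = [nf (lab B (leafstrs A))]"
    using red_wires[OF wf] assms by (simp_all add: g_def wires_of_def)
  moreover have "length (snd g) = 1" using w(2) by (metis length_wires_of length_Cons list.size(3) One_nat_def)
  ultimately show thesis using that[of g] by (simp add: ThompsonF_def root_image_def)
qed

text \<open>The pair \<open>plug s A\<close>, \<open>plug s B\<close> represents the element that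
  acts like the pair \<open>A\<close>, \<open>B\<close> below the address \<open>s\<close> and
  trivially elsewhere.\<close>

fun plug :: "bool list \<Rightarrow> tr \<Rightarrow> tr" where
  "plug [] t = t"
| "plug (c # s) t = (if c then Nd Lf (plug s t) else Nd (plug s t) Lf)"

lemma nlv_plug: "nlv t = nlv u \<Longrightarrow> nlv (plug s t) = nlv (plug s u)"
  by (induction s) auto

text \<open>\<open>p\<close> is the part of the address already traversed, general for the induction
  and later \<open>[]\<close>.\<close>

lemma desc_lab_plug:
  "nlv A = nlv B \<Longrightarrow>
    desc s (lab (plug s B) (map ((@) p) (leafstrs (plug s A)))) = lab B (map ((@) (p @ s)) (leafstrs A))"
proof (induction s arbitrary: p)
  case (Cons c s)
  have e: "(@) p \<circ> Cons c = (@) (p @ [c])" for c by auto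
  have "desc (c # s) (lab (plug (c # s) B) (map ((@) p) (leafstrs (plug (c # s) A)))) =
      desc s (lab (plug s B) (map ((@) (p @ [c])) (leafstrs (plug s A))))"
    using nlv_plug[OF Cons.prems, of s] by (cases c) (simp_all add: e)
  also have "\<dots> = lab B (map ((@) ((p @ [c]) @ s)) (leafstrs A))" by (rule Cons.IH[OF Cons.prems])
  also have "(p @ [c]) @ s = p @ c # s" by simp
  finally show ?case .
qed simp

lemma exists_nlv: "\<exists>t. nlv t = Suc m"
proof (induction m)
  case (Suc m)
  then obtain t where "nlv t = Suc m" by blast
  then have "nlv (Nd t Lf) = Suc (Suc m)" by simp
  then show ?case by blast
qed (auto intro: exI[of _ Lf])

text \<open>Each letter \<open>True\<close> of \<open>s\<close> leaves a subtree on its left and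
  each \<open>False\<close> one on its right. The first such letter absorbs all surplus leaves;
  without any, \<open>s\<close> is outermost on that side.\<close>

lemma tree_with_leaf:
  "count_list s True \<le> p \<Longrightarrow> (count_list s True = 0 \<longrightarrow> p = 0) \<Longrightarrow>
   count_list s False \<le> q \<Longrightarrow> (count_list s False = 0 \<longrightarrow> q = 0) \<Longrightarrow>
    \<exists>t xs ys. leafstrs t = xs @ [s] @ ys \<and> length xs = p \<and> length ys = q"
proof (induction s arbitrary: p q)
  case Nil
  then show ?case by (intro exI[of _ Lf] exI[of _ "[]"]) simp
next
  case (Cons c s)
  show ?case
  proof (cases c)
    case True
    let ?n = "count_list s True"
    obtain m where p: "p = ?n + Suc m" using Cons.prems(1) True by (auto simp: le_iff_add)
    obtain l where l: "nlv l = Suc m" using exists_nlv by blast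
    obtain t xs ys where t: "leafstrs t = xs @ [s] @ ys" "length xs = ?n" "length ys = q"
      using Cons.IH[of ?n q] Cons.prems True by auto
    have "leafstrs (Nd l t) = (map (Cons False) (leafstrs l) @ map (Cons True) xs) @ [c # s] @ map (Cons True) ys"
      using t True by simp
    moreover have "length (map (Cons False) (leafstrs l) @ map (Cons True) xs) = p" "length (map (Cons True) ys) = q"
      using l t p by simp_all
    ultimately show ?thesis by blast
  next
    case False
    let ?n = "count_list s False"
    obtain m where q: "q = ?n + Suc m" using Cons.prems(3) False by (auto simp: le_iff_add)
    obtain r where r: "nlv r = Suc m" using exists_nlv by blast
    obtain t xs ys where t: "leafstrs t = xs @ [s] @ ys" "length xs = p" "length ys = ?n"
      using Cons.IH[of p ?n] Cons.prems False by auto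
    have "leafstrs (Nd t r) = map (Cons False) xs @ [c # s] @ (map (Cons False) ys @ map (Cons True) (leafstrs r))"
      using t False by simp
    moreover have "length (map (Cons False) ys @ map (Cons True) (leafstrs r)) = q" "length (map (Cons False) xs) = p"
      using r t q by simp_all
    ultimately show ?thesis by blast
  qed
qed

abbreviation mixed :: "bool list \<Rightarrow> bool" where
  "mixed s \<equiv> True \<in> set s \<and> False \<in> set s"

text \<open>Both strings are made the leaf number \<open>p\<close> of trees with equally many
  leaves, so the tree pair matches them. The maxima of the letter counts suit \<open>s\<close> and
  \<open>u\<close> at once.\<close>

lemma transitive_on_mixed:
  assumes "mixed s" "mixed u"
  obtains g where "g \<in> ThompsonF" "move g (Str s) = Str u"
proof -
  have pos: "count_list s c \<noteq> 0 \<and> count_list u c \<noteq> 0" for c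
    using assms by (cases c) (auto simp: count_list_0_iff)
  define p where "p = max (count_list s True) (count_list u True)"
  define q where "q = max (count_list s False) (count_list u False)"
  obtain A xs ys where A: "leafstrs A = xs @ [u] @ ys" "length xs = p" "length ys = q"
    using tree_with_leaf[of u p q] pos by (auto simp: p_def q_def)
  obtain B xs' ys' where B: "leafstrs B = xs' @ [s] @ ys'" "length xs' = p" "length ys' = q"
    using tree_with_leaf[of s p q] pos by (auto simp: p_def q_def)
  have n: "nlv A = nlv B" using length_leafstrs[of A] length_leafstrs[of B] A B by simp
  obtain g where g: "g \<in> ThompsonF" "root_image g = nf (lab B (leafstrs A))" using ThompsonF_of_trees[OF n] .
  have "map (\<lambda>s. desc s (lab B (leafstrs A))) (leafstrs B) ! p = map Str (leafstrs A) ! p"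
    using desc_lab[of "leafstrs A" B] n by simp
  then have "desc s (lab B (leafstrs A)) = Str u" unfolding A(1) B(1) using A(2) B(2) by (simp add: nth_append)
  then show thesis using that g by (simp add: desc_nf)
qed

lemma push_fixedD:
  "push g E = E \<Longrightarrow> e \<in> E \<Longrightarrow> regular g e \<Longrightarrow> down (move g e) \<subseteq> E"
  unfolding push_def by blast

text \<open>Once one input of a merge has a merge as image, \<open>mk\<close> cannot collapse, so
  the caret at \<open>s\<close> persists all the way down to \<open>x\<close>.\<close>

lemma move_label_Mrg:
  assumes "move g (Str s) = Mrg a b" "Str s \<in> evs (move g (Str s))" "s \<in> set (labels x)"
  shows "\<not> is_caret (move g x) \<and> Str s \<in> evs (move g x)"
  using assms(3)
proof (induction x)
  case (Mrg y z)
  then have "\<exists>w\<in>{y, z}. \<not> is_caret (move g w) \<and> Str s \<in> evs (move g w)" by auto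
  then obtain w where w: "w \<in> {y, z}" "\<not> is_caret (move g w)" "Str s \<in> evs (move g w)" by blast
  obtain c d where "move g w = Mrg c d" using w(2) by (cases "move g w") auto
  then show ?case using w by auto
qed (use assms in simp)

text \<open>The created caret conflicts with the merge: a vertex containing the merge has
  \<open>s\<close> among its leaf strings and cannot also split \<open>s\<close>.\<close>

lemma fixed_no_merge:
  assumes E: "eprofile E" and fixed: "\<And>g. g \<in> ThompsonF \<Longrightarrow> push g E = E" and e: "Mrg a b \<in> E"
  shows False
proof -
  define s where "s = hd (labels (Mrg a b))"
  have s: "s \<in> set (labels (Mrg a b))" unfolding s_def by (rule hd_in_set) (rule labels_nonempty)
  \<comment> \<open>The two trees with three leaves, a standard generator of \<open>F\<close>; with
    fewer leaves every tree pair is trivial.\<close>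
  define A where "A = Nd (Nd Lf Lf) Lf"
  define B where "B = Nd Lf (Nd Lf Lf)"
  have n: "nlv A = nlv B" by (simp add: A_def B_def)
  obtain g where g: "g \<in> ThompsonF" "root_image g = nf (lab (plug s B) (leafstrs (plug s A)))"
    using ThompsonF_of_trees nlv_plug[OF n] by metis
  have "map ((@) []) (leafstrs (plug s A)) = leafstrs (plug s A)" by (simp add: map_idI)
  then have "move g (Str s) = nf (lab B (map ((@) s) (leafstrs A)))"
    using desc_lab_plug[OF n, of s "[]"] g(2) by (simp add: desc_nf)
  also have "\<dots> = Mrg (Str (s @ [False, False])) (mk (Str (s @ [False, True])) (Str (s @ [True])))"
    by (auto simp: A_def B_def intro!: mk_nodip) (auto simp: mk_def split: if_splits)
  finally have move: "move g (Str s) = Mrg (Str (s @ [False, False])) (mk (Str (s @ [False, True])) (Str (s @ [True])))" .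
  moreover have "Str s \<in> evs \<dots>" by (simp add: strict_prefix_def)
  ultimately have ge: "\<not> is_caret (move g (Mrg a b)) \<and> Str s \<in> evs (move g (Mrg a b))"
    using move_label_Mrg s by metis
  then obtain c d where cd: "move g (Mrg a b) = Mrg c d" by (cases "move g (Mrg a b)") auto
  have "down (move g (Mrg a b)) \<subseteq> E"
    using push_fixedD[OF fixed[OF g(1)] e] ge by (simp add: regular_def)
  then have "Str s \<in> E" using ge cd by auto
  then have "{Str s, Mrg a b} \<subseteq> E" "finite {Str s, Mrg a b}" using e by auto
  then obtain v where v: "v \<in> Vert" "{Str s, Mrg a b} \<subseteq> evt v" using eprofileD(3)[OF E] by metis
  then obtain l where l: "l \<in> set (labelsF (wires_of v))" "strict_prefix s l"
    unfolding evt_def using Str_in_events by auto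
  obtain w where "w \<in> set (wires_of v)" "Mrg a b \<in> evs w" using v(2) by (auto simp: evt_def events_def)
  then have "s \<in> set (labelsF (wires_of v))" using labels_Mrg_in_evs s by fastforce
  then show False using Conf_antichain[OF wires_of_Conf[OF v(1)]] l by (auto simp: strict_prefix_def)
qed

text \<open>Nonempty pruned trees of descriptive set theory; these are the merge-free
  profiles.\<close>

definition pruned :: "bool list set \<Rightarrow> bool" where
  "pruned X \<longleftrightarrow> X \<noteq> {} \<and> (\<forall>s\<in>X. \<forall>p. prefix p s \<longrightarrow> p \<in> X) \<and> (\<forall>s\<in>X. \<exists>t\<in>X. strict_prefix s t)"

fun full_tree :: "nat \<Rightarrow> tr" where
  "full_tree 0 = Lf"
| "full_tree (Suc n) = Nd (full_tree n) (full_tree n)"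

lemma leafstrs_full_tree: "length s = n \<Longrightarrow> s \<in> set (leafstrs (full_tree n))"
proof (induction n arbitrary: s)
  case (Suc n)
  obtain c t where "s = c # t" "length t = n" using Suc.prems by (cases s) simp_all
  then show ?case using Suc.IH by (cases c) auto
qed simp

lemma eprofile_Str: "eprofile (Str ` X) \<longleftrightarrow> pruned X"
proof
  assume E: "eprofile (Str ` X)"
  show "pruned X" unfolding pruned_def
  proof (intro conjI ballI allI impI)
    show "X \<noteq> {}" using eprofileD(1)[OF E] by simp
    show "p \<in> X" if "s \<in> X" "prefix p s" for s p using eprofileD(5)[OF E, of "Str s"] that by auto
    show "\<exists>t\<in>X. strict_prefix s t" if "s \<in> X" for s
      using eprofileD(4)[OF E, of "Str s"] that by (auto simp: strict_prefix_def)
  qed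
next
  assume X: "pruned X"
  show "eprofile (Str ` X)" unfolding eprofile_def
  proof (intro conjI ballI allI impI)
    show "Str ` X \<noteq> {}" using X by (simp add: pruned_def)
    show "Str ` X \<subseteq> Ev" using Str_Ev by blast
    show "down e \<subseteq> Str ` X" if "e \<in> Str ` X" for e using X that unfolding pruned_def by auto
    show "\<exists>f\<in>Str ` X. e \<in> down f \<and> e \<noteq> f" if "e \<in> Str ` X" for e
    proof -
      obtain s where s: "e = Str s" "s \<in> X" using \<open>e \<in> Str ` X\<close> by blast
      then obtain t where "t \<in> X" "strict_prefix s t" using X unfolding pruned_def by blast
      then show ?thesis using s by (intro bexI[of _ "Str t"]) (auto simp: strict_prefix_def)
    qed
    show "\<exists>v\<in>Vert. F \<subseteq> evt v" if F: "F \<subseteq> Str ` X \<and> finite F" for F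
    proof -
      \<comment> \<open>Deeper than every caret of \<open>F\<close>; the inserted 0 keeps
        \<open>Max\<close> meaningful for empty \<open>F\<close>.\<close>
      define n where "n = Suc (Max (insert 0 (msize ` F)))"
      have "Str s \<in> evt (full_tree n, replicate (nlv (full_tree n)) Lf)" if "Str s \<in> F" for s
      proof -
        have "msize (Str s) \<le> Max (insert 0 (msize ` F))" 
          by (intro Max_ge finite.insertI finite_imageI insertI2 imageI that) (use F in auto)
        then have "length s < n" by (simp add: n_def)
        then have "s @ replicate (n - length s) False \<in> set (leafstrs (full_tree n))"
          "strict_prefix s (s @ replicate (n - length s) False)"
          by (auto intro!: leafstrs_full_tree simp: strict_prefix_def)
        then show ?thesis unfolding evt_tree by blast
      qed
      then show ?thesis using F by (intro bexI[OF _ tree_Vert(1)[of "full_tree n"]]) auto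
    qed
  qed
qed

text \<open>Invariance is asked only where the image of a string is a string. For the reverse
  inclusion, each element lies above-closed under a longer string regular for the inverse, and
  pulling that string back stays in \<open>X\<close>.\<close>

lemma push_Str_eq:
  assumes X: "pruned X"
    and inv: "\<And>g s s'. g \<in> ThompsonF \<Longrightarrow> s \<in> X \<Longrightarrow> move g (Str s) = Str s' \<Longrightarrow> s' \<in> X"
    and g: "g \<in> ThompsonF"
  shows "push g (Str ` X) = Str ` X"
proof
  show "push g (Str ` X) \<subseteq> Str ` X"
  proof
    fix f assume "f \<in> push g (Str ` X)"
    then obtain s where s: "s \<in> X" "regular g (Str s)" "f \<in> down (move g (Str s))" unfolding push_def by blast
    then obtain s' where s': "move g (Str s) = Str s'" using is_caretD by (auto simp: regular_def)
    then have "s' \<in> X" using inv g s by blast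
    moreover obtain p where "f = Str p" "prefix p s'" using s(3) s' by auto
    ultimately show "f \<in> Str ` X" using X unfolding pruned_def by blast
  qed
  show "Str ` X \<subseteq> push g (Str ` X)"
  proof
    fix f assume f: "f \<in> Str ` X"
    have sg: "inverse_pic g \<in> ThompsonF" using g by (rule inverse_pic_ThompsonF)
    have "eprofile (Str ` X)" using X eprofile_Str by blast
    then obtain e where "e \<in> Str ` X" and e: "f \<in> down e" "regular (inverse_pic g) e"
      using eprofile_regular[OF _ f sg] by blast
    then obtain s where s: "s \<in> X" "e = Str s" by blast
    then obtain s' where s': "move (inverse_pic g) (Str s) = Str s'" using e(2) is_caretD by (auto simp: regular_def)
    then have "s' \<in> X" using inv sg s by blast
    moreover have "move g (Str s') = Str s" using move_inverse_pic(1)[OF g, of "Str s"] s' by simp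
    moreover from this have "regular g (Str s')" unfolding regular_def by simp
    ultimately show "f \<in> push g (Str ` X)" unfolding push_def using e(1) s(2) by force
  qed
qed

section \<open>The two rays and the merge-free profiles inside them\<close>

abbreviation ray :: "bool \<Rightarrow> bool list set" where
  "ray c \<equiv> range (\<lambda>k. replicate k c)"

fun endlabel :: "bool \<Rightarrow> wire \<Rightarrow> bool list" where
  "endlabel c (Str s) = s"
| "endlabel c (Mrg a b) = endlabel c (if c then b else a)"

lemma endlabel_eq: "endlabel c w = (if c then last (labels w) else hd (labels w))"
  by (induction w) auto

text \<open>Always turning to side \<open>c\<close> follows the outermost branch; after its label is
  reached, each further turn appends \<open>c\<close>.\<close>

lemma desc_ray: "desc (replicate k c) w = Str s \<Longrightarrow> \<exists>j. s = endlabel c w @ replicate j c"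
proof (induction k arbitrary: w)
  case 0
  then show ?case by (auto intro: exI[of _ 0])
next
  case (Suc k)
  show ?case
  proof (cases w)
    case (Str a)
    then show ?thesis using Suc.prems by (intro exI[of _ "Suc k"]) simp
  next
    case (Mrg a b)
    then show ?thesis using Suc.IH[of "pr c w"] Suc.prems by simp
  qed
qed

lemma end_leaf: "(if c then last (leafstrs t) else hd (leafstrs t)) \<in> ray c"
proof (induction t)
  case Lf
  then show ?case by (auto intro: range_eqI[of _ _ 0])
next
  case (Nd l r)
  have ray: "s \<in> ray c \<Longrightarrow> c # s \<in> ray c" for s by (auto intro: range_eqI[of _ _ "Suc _"])
  show ?case
  proof (cases c)
    case True
    then show ?thesis using ray Nd(2) by (simp add: last_map)
  next
    case False
    then show ?thesis using ray Nd(1) by (simp add: hd_map)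
  qed
qed

text \<open>The outermost leaf of \<open>B\<close> on side \<open>c\<close> carries that of
  \<open>A\<close>, which is a power of \<open>c\<close>. Geometrically, \<open>F\<close> fixes both
  endpoints of the interval.\<close>

lemma ray_invariant:
  assumes g: "g \<in> ThompsonF" and s: "s \<in> ray c" "move g (Str s) = Str s'"
  shows "s' \<in> ray c"
proof -
  obtain A B where AB: "nlv A = nlv B" "root_image g = lab B (leafstrs A)" using ThompsonF_obtain[OF g] by metis
  have "endlabel c (root_image g) \<in> ray c"
    using end_leaf[of c A] by (cases c) (simp_all add: AB endlabel_eq labels_lab)
  then obtain i where i: "endlabel c (root_image g) = replicate i c" by blast
  obtain k where "s = replicate k c" using s(1) by blast
  then obtain j where "s' = endlabel c (root_image g) @ replicate j c"
    using desc_ray[of k c "root_image g" s'] s(2) by auto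
  then show ?thesis using i by (auto simp: replicate_add[symmetric])
qed

lemma prefix_replicate: "prefix p (replicate k c) \<Longrightarrow> p \<in> ray c"
proof -
  assume "prefix p (replicate k c)"
  then obtain q where "replicate k c = p @ q" by (auto simp: prefix_def)
  then have "p = take (length p) (replicate k c)" by simp
  then show ?thesis by (metis take_replicate rangeI)
qed

lemma ray_strict: "\<exists>t\<in>ray c. strict_prefix (replicate k c) t"
proof -
  have "replicate (Suc k) c = replicate k c @ [c]" by (simp add: replicate_append_same)
  then have "strict_prefix (replicate k c) (replicate (Suc k) c)" by (simp add: strict_prefix_def)
  then show ?thesis by blast
qed

lemma pruned_ray: "pruned (ray c)"
  unfolding pruned_def using prefix_replicate ray_strict by blast

lemma pruned_Un: "pruned X \<Longrightarrow> pruned Y \<Longrightarrow> pruned (X \<union> Y)"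
  unfolding pruned_def by (metis UnE UnI1 UnI2 sup_eq_bot_iff)

lemma pruned_UNIV: "pruned UNIV"
  unfolding pruned_def by (auto intro!: exI[of _ "_ @ [True]"] simp: strict_prefix_def)

lemma not_mixed: "\<not> mixed s \<longleftrightarrow> s \<in> ray False \<union> ray True"
proof
  assume "\<not> mixed s"
  then obtain c where "c \<notin> set s" by blast
  then have "x = (\<not> c)" if "x \<in> set s" for x using that by (cases "x = c") auto
  then have "s = replicate (length s) (\<not> c)" by (simp add: replicate_length_same)
  then have "s \<in> ray (\<not> c)" by blast
  then show "s \<in> ray False \<union> ray True" by (cases c) auto
qed auto

lemma pruned_long:
  assumes X: "pruned X" and s: "s \<in> X" shows "\<exists>t\<in>X. prefix s t \<and> n \<le> length t"
proof (induction n)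
  case (Suc n)
  then obtain t where t: "t \<in> X" "prefix s t" "n \<le> length t" by blast
  then obtain t' where t': "t' \<in> X" "strict_prefix t t'" using X unfolding pruned_def by blast
  then have "prefix s t'" using t(2) by (meson prefix_order.order_trans prefix_order.less_imp_le)
  then show ?case using t' t prefix_length_less[OF t'(2)] by (intro bexI[of _ t']) auto
qed (use s in blast)

text \<open>A string containing \<open>c\<close> has arbitrarily long extensions in
  \<open>X\<close>; these are still constant, hence powers of \<open>c\<close>, and their prefixes
  fill \<open>ray c\<close>.\<close>

lemma pruned_subset_rays:
  assumes X: "pruned X" and sub: "X \<subseteq> ray False \<union> ray True"
  shows "X = ray False \<or> X = ray True \<or> X = ray False \<union> ray True"
proof -
  have full_tree: "ray c \<subseteq> X" if "s \<in> X" "c \<in> set s" for s c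
  proof clarify
    fix n
    obtain t where t: "t \<in> X" "prefix s t" "n \<le> length t" using pruned_long[OF X \<open>s \<in> X\<close>] by blast
    have "c \<in> set t" using t(2) \<open>c \<in> set s\<close> set_mono_prefix by blast
    moreover obtain d m where "t = replicate m d" using sub t(1) by blast
    ultimately have "t = replicate (length t) c" by (simp split: if_splits)
    then have "t = replicate n c @ replicate (length t - n) c"
      using t(3) by (metis replicate_add le_add_diff_inverse)
    then have "prefix (replicate n c) t" by (metis prefixI)
    then show "replicate n c \<in> X" using X t(1) unfolding pruned_def by blast
  qed
  have nil: "s \<in> ray (\<not> c)" if "s \<in> X" "c \<notin> set s" for s c
  proof -
    obtain d m where "s = replicate m d" using sub \<open>s \<in> X\<close> by blast
    moreover from this have "m = 0 \<or> d = (\<not> c)" using \<open>c \<notin> set s\<close> by (cases m; cases "d = c") auto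
    ultimately have "s = replicate m (\<not> c)" by auto
    then show ?thesis by blast
  qed
  \<comment> \<open>The empty string lies on both rays, so a nonempty one is needed to tell which
    ray is present.\<close>
  obtain s where "s \<in> X" "s \<noteq> []"
    using X unfolding pruned_def by (metis strict_prefix_simps(1) ex_in_conv)
  then obtain c where c: "c \<in> set s" by (cases s) auto
  then have rc: "ray c \<subseteq> X" using full_tree \<open>s \<in> X\<close> by blast
  show ?thesis
  proof (cases "\<exists>t\<in>X. (\<not> c) \<in> set t")
    case True
    then have "ray (\<not> c) \<subseteq> X" using full_tree by blast
    then show ?thesis using rc sub by (cases c) auto
  next
    case False
    then have "X \<subseteq> ray c" using nil[of _ "\<not> c"] by auto
    then show ?thesis using rc by (cases c) auto
  qed
qed

lemma fixed_cases:
  assumes E: "eprofile E" and fixed: "\<And>g. g \<in> ThompsonF \<Longrightarrow> push g E = E"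
  obtains X where "E = Str ` X" "X \<in> {ray False, ray True, ray False \<union> ray True, UNIV}"
proof -
  define X where "X = {s. Str s \<in> E}"
  have "\<exists>s. e = Str s" if "e \<in> E" for e
    using fixed_no_merge[OF E fixed] that by (cases e) auto
  then have EX: "E = Str ` X" unfolding X_def by blast
  then have X: "pruned X" using E eprofile_Str by simp
  show thesis
  proof (cases "X \<subseteq> ray False \<union> ray True")
    case True
    then show thesis using that EX pruned_subset_rays[OF X] by blast
  next
    case False
    then obtain s where s: "s \<in> X" "mixed s" using not_mixed by blast
    have mix: "u \<in> X" if u: "mixed u" for u
    proof -
      obtain g where g: "g \<in> ThompsonF" "move g (Str s) = Str u" using transitive_on_mixed[OF s(2) u] .
      have "down (move g (Str s)) \<subseteq> E"
        using push_fixedD[OF fixed[OF g(1)], of "Str s"] s(1) g(2) by (simp add: X_def regular_def)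
      then show ?thesis using g(2) self_in_down by (auto simp: X_def)
    qed
    have "u \<in> X" for u
    proof -
      \<comment> \<open>Every string has a mixed extension, so prefix closure yields all
        strings.\<close>
      have "u @ [False, True] \<in> X" using mix by simp
      then show ?thesis using X prefixI unfolding pruned_def by blast
    qed
    then show thesis using that EX by blast
  qed
qed

theorem theorem5p1:
  shows "{\<H>. profile \<H> \<and> (\<forall>g\<in>ThompsonF. pact g \<H> = \<H>)} = {DeltaL, DeltaR, DeltaLR, DeltaInf}
         \<and> card {DeltaL, DeltaR, DeltaLR, DeltaInf} = 4"
proof -
  let ?XX = "{ray False, ray True, ray False \<union> ray True, UNIV}"
  have D: "{DeltaL, DeltaR, DeltaLR, DeltaInf} = (\<lambda>X. halfsp ` Str ` X) ` ?XX"
    by (simp add: DeltaL_def DeltaR_def DeltaLR_def DeltaInf_def PS_eq)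
  have "profile \<H> \<and> (\<forall>g\<in>ThompsonF. pact g \<H> = \<H>) \<longleftrightarrow> \<H> \<in> (\<lambda>X. halfsp ` Str ` X) ` ?XX" for \<H>
  proof
    assume *: "profile \<H> \<and> (\<forall>g\<in>ThompsonF. pact g \<H> = \<H>)"
    then obtain E where E: "eprofile E" "\<H> = halfsp ` E" using profile_obtain by blast
    have "push g E = E" if "g \<in> ThompsonF" for g
      using pact_fixed_iff[OF E(1) that] * that E(2) by simp
    then obtain X where "E = Str ` X" "X \<in> ?XX" using fixed_cases[OF E(1)] by metis
    then show "\<H> \<in> (\<lambda>X. halfsp ` Str ` X) ` ?XX" using E(2) by (simp only: image_eqI)
  next
    assume "\<H> \<in> (\<lambda>X. halfsp ` Str ` X) ` ?XX"
    then obtain X where X: "X \<in> ?XX" "\<H> = halfsp ` Str ` X" by blast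
    have pruned: "pruned X" using X(1) pruned_ray pruned_Un pruned_UNIV by auto
    have inv: "s' \<in> X" if "g \<in> ThompsonF" "s \<in> X" "move g (Str s) = Str s'" for g s s'
      using X(1) that(2) ray_invariant[OF that(1) _ that(3)] by (elim insertE emptyE) auto
    have E: "eprofile (Str ` X)" using pruned eprofile_Str by blast
    then have "profile \<H>" using profile_iff[OF eprofileD(2)[OF E]] X(2) by blast
    moreover have "pact g \<H> = \<H>" if "g \<in> ThompsonF" for g
    proof -
      have "push g (Str ` X) = Str ` X" by (rule push_Str_eq[OF pruned _ that]) (rule inv)
      then show ?thesis unfolding X(2) using pact_fixed_iff[OF E that] by simp
    qed
    ultimately show "profile \<H> \<and> (\<forall>g\<in>ThompsonF. pact g \<H> = \<H>)" by blast
  qed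
  moreover have "card ((\<lambda>X. halfsp ` Str ` X) ` ?XX) = 4"
  proof -
    have "inj_on (\<lambda>X. halfsp ` Str ` X) ?XX"
    proof (rule inj_onI)
      fix X Y assume "halfsp ` Str ` X = halfsp ` Str ` Y"
      moreover have "Str ` X \<subseteq> Ev" "Str ` Y \<subseteq> Ev" using Str_Ev by auto
      ultimately have "Str ` X = Str ` Y" using inj_on_image_eq_iff[OF inj_halfsp] by metis
      moreover have "inj Str" by (rule injI) simp
      ultimately show "X = Y" by (simp add: inj_image_eq_iff)
    qed
    moreover have "card ?XX = 4"
    proof -
      have r: "[False] \<in> ray False" "[True] \<in> ray True" by (auto intro: range_eqI[of _ _ 1])
      \<comment> \<open>The mixed string \<open>[True, False]\<close> separates \<open>UNIV\<close>
        from the union of the rays.\<close>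
      have n: "[True] \<notin> ray False" "[False] \<notin> ray True" "[True, False] \<notin> ray False \<union> ray True"
        using not_mixed[of "[True, False]"] by (auto simp: list_eq_iff_nth_eq)
      have "ray False \<noteq> ray True" "ray False \<noteq> ray False \<union> ray True" "ray True \<noteq> ray False \<union> ray True"
        "ray False \<noteq> UNIV" "ray True \<noteq> UNIV" "ray False \<union> ray True \<noteq> UNIV"
        using r n by blast+
      then show ?thesis by simp
    qed
    ultimately show ?thesis by (simp only: card_image)
  qed
  moreover have "{\<H>. profile \<H> \<and> (\<forall>g\<in>ThompsonF. pact g \<H> = \<H>)} = (\<lambda>X. halfsp ` Str ` X) ` ?XX"
    using calculation(1) by (intro set_eqI) (simp only: mem_Collect_eq)
  ultimately show ?thesis unfolding D by (intro conjI)
qed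

end
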